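(* Let $T_0>0$ be a real number. Assume that: (i) $\Omega$ is endowed with a metric $\rho$, $\nu$ is a Borel measure for the topology induced by $\rho$, and there exists a real number $r_0\ge1$ such that Property $(\mathcal P_{r_0})$ holds for $(\Omega,\mathcal F,\nu,T)$; (ii) $F:\mathbf R^d\times\Omega\to\mathbf R^d$ is uniformly $\eta$-Hölder continuous in the second parameter. Then $$\forall p\in[1,+\infty),\qquad\sup_{x\in\mathbf R^d}\left\|\sup_{t\in[0,T_0]}|e_t^\varepsilon(x,\cdot)|_\infty\right\|_{L^{2p}}=O(\sqrt\varepsilon)\quad(\varepsilon\to0).$$
   Context: $(\Omega,\mathcal F,\nu,T)$ is an invertible probability dynamical system: $(\Omega,\mathcal F,\nu)$ is a probability space, $T:\Omega\to\Omega$ is measurable and $\nu$-preserving, and $T$ is one-to-one from a set $\Omega\setminus N_0$ onto a set $\Omega\setminus N_1$ with $\nu(N_0)=\nu(N_1)=0$, with measurable inverse $T^{-1}$. $\mathcal F$ is the Borel $\sigma$-algebra of the metric $\rho$. $\mathbf E_\nu[f]=\int_\Omega f\,d\nu$ and $\mathrm{Cov}_\nu(f,g)=\mathbf E_\nu[fg]-\mathbf E_\nu[f]\mathbf E_\nu[g]$; $L^{2p}$ norms are with respect to $\nu$. A real number $\eta\in(0,1]$ is fixed. For a bounded $\eta$-Hölder continuous $f:\Omega\to\mathbf C$, $\|f\|_\infty=\sup|f|$ and $C_f^{(\eta)}=\sup_{x\ne y}\frac{|f(x)-f(y)|}{\rho(x,y)^\eta}$. Property $(\mathcal P_r)$ (for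 a real $r\ge1$): there exist a polynomial function $P_r$ with real nonnegative coefficients and a real number $\delta_r\in(0,1)$ such that, for all positive integers $m,m'$, all bounded $\eta$-Hölder continuous functions $f_1,\dots,f_{m+m'}:\Omega\to\mathbf C$, all increasing finite sequences of nonnegative integers $(k_1,\dots,k_m)$ and $(l_1,\dots,l_{m'})$ and every nonnegative integer $n$, $$\left|\mathrm{Cov}_\nu\left(\prod_{i=1}^m f_i\circ T^{k_i},\prod_{j=1}^{m'}f_{m+j}\circ T^{n+l_j}\right)\right|\le\left(\prod_{i=1}^{m+m'}\|f_i\|_\infty+\sum_{i=1}^{m+m'}C^{(\eta)}_{f_i}\prod_{j\ne i}\|f_j\|_\infty\right)P_r(l_{m'})\,\delta_r^{\,n-rk_m}.$$ $d\ge1$ is an integer and $|\cdot|_\infty$ is the maximum norm on $\mathbf R^d$. $F:\mathbf R^d\times\Omega\to\mathbf R^d$ is measurable, uniformly bounded and uniformly Lipschitz continuous in the first parameter. $\bar F(x)=\int_\Omega F(x,\omega)\,d\nu(\omega)$. For $\varepsilon>0$ and $(x,\omega)\in\mathbf R^d\times\Omega$, $t\mapsto x_t^\varepsilon(x,\omega)$ ($t\ge0$) is the continuous solution of $\frac{dx_t^\varepsilon}{dt}(x,\omega)=F(x_t^\varepsilon(x,\omega),T^{\lfloor t/\varepsilon\rfloor}(\omega))$ for $t\notin\varepsilon\mathbf Z$, with $x_0^\varepsilon(x,\omega)=x$; $t\mapsto w_t(x)$ is the solution of $\frac{dw_t}{dt}(x)=\bar F(w_t(x))$, $w_0(x)=x$;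 and $e_t^\varepsilon(x,\omega)=x_t^\varepsilon(x,\omega)-w_t(x)$. *)

theory Defs
  imports "HOL-Analysis.Analysis" "HOL-Probability.Probability"
    "HOL-Computational_Algebra.Polynomial"
begin

definition measure_preserving_map :: "'w measure \<Rightarrow> ('w \<Rightarrow> 'w) \<Rightarrow> bool" where
  "measure_preserving_map M T \<longleftrightarrow> T \<in> measurable M M \<and> distr M M T = M"

definition invertible_mod_null :: "'w measure \<Rightarrow> ('w \<Rightarrow> 'w) \<Rightarrow> bool" where
  "invertible_mod_null M T \<longleftrightarrow>
     (\<exists>N0 \<in> null_sets M. \<exists>N1 \<in> null_sets M.
        bij_betw T (space M - N0) (space M - N1) \<and>
        the_inv_into (space M - N0) T \<in>
          measurable (restrict_space M (space M - N1)) (restrict_space M (space M - N0)))"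

definition invertible_prob_system :: "'w measure \<Rightarrow> ('w \<Rightarrow> 'w) \<Rightarrow> bool" where
  "invertible_prob_system M T \<longleftrightarrow>
     prob_space M \<and> measure_preserving_map M T \<and> invertible_mod_null M T"

definition holder_bound ::
  "real \<Rightarrow> real \<Rightarrow> ('w::metric_space \<Rightarrow> 'b::real_normed_vector) \<Rightarrow> bool" where
  "holder_bound \<eta> C f \<longleftrightarrow> (\<forall>x y. norm (f x - f y) \<le> C * dist x y powr \<eta>)"

definition bounded_holder :: "real \<Rightarrow> ('w::metric_space \<Rightarrow> complex) \<Rightarrow> bool" where
  "bounded_holder \<eta> f \<longleftrightarrow> bounded (range f) \<and> (\<exists>C. holder_bound \<eta> C f)"

definition sup_norm :: "('w \<Rightarrow> complex) \<Rightarrow> real" where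
  "sup_norm f = (SUP x. norm (f x))"

text \<open>The supremum runs over all pairs, diagonal included: there the quotient is
  \<open>0 / 0 = 0\<close>. This does not change a supremum of nonnegative numbers, and gives
  the value \<open>0\<close> when the space is a single point.\<close>

definition holder_const :: "real \<Rightarrow> ('w::metric_space \<Rightarrow> complex) \<Rightarrow> real" where
  "holder_const \<eta> f = (SUP (x, y). norm (f x - f y) / dist x y powr \<eta>)"

definition covar :: "'w measure \<Rightarrow> ('w \<Rightarrow> complex) \<Rightarrow> ('w \<Rightarrow> complex) \<Rightarrow> complex" where
  "covar M f g =
     (\<integral>\<omega>. f \<omega> * g \<omega> \<partial>M) - (\<integral>\<omega>. f \<omega> \<partial>M) * (\<integral>\<omega>. g \<omega> \<partial>M)"

text \<open>The multiple decorrelation property \<open>(P_r)\<close>. Increasing sequences are taken to be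
  strictly increasing. The property for nondecreasing sequences is equivalent: factors
  with a common time may be multiplied together, which does not increase the right-hand side.\<close>

definition decorrelation_property ::
  "'w::metric_space measure \<Rightarrow> ('w \<Rightarrow> 'w) \<Rightarrow> real \<Rightarrow> real \<Rightarrow> bool" where
  "decorrelation_property M T \<eta> r \<longleftrightarrow>
     (\<exists>(P :: real poly) (\<delta> :: real).
        (\<forall>i. coeff P i \<ge> 0) \<and> 0 < \<delta> \<and> \<delta> < 1 \<and>
        (\<forall>(m::nat) (m'::nat) (f :: nat \<Rightarrow> 'w \<Rightarrow> complex) (k :: nat \<Rightarrow> nat) (l :: nat \<Rightarrow> nat) (n::nat).
           1 \<le> m \<longrightarrow> 1 \<le> m' \<longrightarrow>
           (\<forall>i\<in>{1..m + m'}. bounded_holder \<eta> (f i)) \<longrightarrow>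
           strict_mono_on {1..m} k \<longrightarrow> strict_mono_on {1..m'} l \<longrightarrow>
           norm (covar M
                   (\<lambda>\<omega>. \<Prod>i=1..m. f i ((T ^^ k i) \<omega>))
                   (\<lambda>\<omega>. \<Prod>j=1..m'. f (m + j) ((T ^^ (n + l j)) \<omega>)))
           \<le> ((\<Prod>i=1..m + m'. sup_norm (f i)) +
               (\<Sum>i=1..m + m'. holder_const \<eta> (f i) *
                   (\<Prod>j\<in>{1..m + m'} - {i}. sup_norm (f j))))
             * poly P (real (l m')) * \<delta> powr (real n - r * real (k m))))"

definition averaged_field ::
  "'w measure \<Rightarrow> ((real^'d) \<times> 'w \<Rightarrow> real^'d) \<Rightarrow> real^'d \<Rightarrow> real^'d" where
  "averaged_field M F x = (\<integral>\<omega>. F (x, \<omega>) \<partial>M)"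

definition perturbed_solution ::
  "((real^'d) \<times> 'w \<Rightarrow> real^'d) \<Rightarrow> ('w \<Rightarrow> 'w) \<Rightarrow> real \<Rightarrow> real^'d \<Rightarrow> 'w \<Rightarrow>
     (real \<Rightarrow> real^'d) \<Rightarrow> bool" where
  "perturbed_solution F T \<epsilon> x \<omega> X \<longleftrightarrow>
     continuous_on {0..} X \<and> X 0 = x \<and>
     (\<forall>t\<ge>0. t \<notin> {\<epsilon> * of_int z |z. True} \<longrightarrow>
        (X has_vector_derivative F (X t, (T ^^ nat \<lfloor>t / \<epsilon>\<rfloor>) \<omega>)) (at t))"

definition averaged_solution ::
  "(real^'d \<Rightarrow> real^'d) \<Rightarrow> real^'d \<Rightarrow> (real \<Rightarrow> real^'d) \<Rightarrow> bool" where
  "averaged_solution G x W \<longleftrightarrow>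
     W 0 = x \<and> (\<forall>t\<ge>0. (W has_vector_derivative G (W t)) (at t within {0..}))"

text \<open>Extended-valued \<open>L^q\<close> norm; a function that is not measurable or not
  \<open>q\<close>-integrable has norm \<open>\<infinity>\<close>, so finiteness of the norm means membership in \<open>L^q\<close>.\<close>

definition Lq_norm :: "'w measure \<Rightarrow> real \<Rightarrow> ('w \<Rightarrow> real) \<Rightarrow> ennreal" where
  "Lq_norm M q f =
     (if f \<in> borel_measurable M \<and> integrable M (\<lambda>\<omega>. \<bar>f \<omega>\<bar> powr q)
      then ennreal ((\<integral>\<omega>. \<bar>f \<omega>\<bar> powr q \<partial>M) powr (1 / q)) else \<infinity>)"

end

theory Submission
  imports Defs
begin

text \<open>
Write \<open>f k u = F (u, (T ^^ k) \<omega>)\<close> for the field on the \<open>k\<close>-th cell of length \<open>\<epsilon>\<close>. A discrete Gronwall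
argument (\<open>averaging_error\<close>) bounds the difference of the perturbed and the averaged solution on
\<open>{0..T0}\<close> by a constant times \<open>\<epsilon>\<close> times the largest partial sum, over \<open>n \<le> N\<close> with \<open>N\<close> of order
\<open>1 / \<epsilon>\<close>, of the fluctuations \<open>f k (w k) - G (w k)\<close>, up to an error of order \<open>\<epsilon>\<close>. Here \<open>G\<close> is the averaged
field and \<open>w k\<close> is the averaged solution at time \<open>k * \<epsilon>\<close>. The points \<open>w k\<close> are deterministic, so the
fluctuations are \<open>g k \<circ> T ^^ k\<close> with centred, uniformly bounded and uniformly Hoelder continuous functions
\<open>g k\<close>. So the rate \<open>sqrt \<epsilon>\<close> follows once their maximal partial sum is known to be of size \<open>sqrt N\<close> in every
\<open>L\<^sup>q\<close>, uniformly in the family \<open>g\<close>.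

The moment of order \<open>q\<close> of a sum over a set \<open>V\<close> of times expands into correlations along tuples of
\<open>q\<close> times. A tuple always has a gap that is comparable to its diameter and much longer than the
part of the tuple before it (\<open>exists_dominating_gap\<close>). At such a gap the decorrelation property
replaces the correlation by the product of the correlations of the two blocks, with an error that
decays exponentially in the diameter (\<open>correlation_splitting\<close>). The errors add up to a multiple of
\<open>card V\<close>, the products factorise, and induction on \<open>q\<close> gives the bound \<open>sqrt (card V) ^ q\<close>
(\<open>sum_correlation_bound\<close>, \<open>moment_bound\<close>). A dyadic recursion passes from moments of sums over
intervals to moments of the maximal partial sum (\<open>maximal_partial_sums\<close>).

The remaining point is that the error is a random variable: solutions are limits of
Euler iterates (\<open>perturbed_solution_measurable\<close>), and by continuity the supremum over time may be
taken over a countable set (\<open>borel_measurable_SUP_interval\<close>).\<close>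

section \<open>A dominating gap in a finite set of times\<close>

text \<open>If every jump from \<open>s\<close> to the next point were smaller than \<open>R (s - a)\<close> or than
\<open>D = (b - a) / (2 + R) ^ card A\<close>, then each jump would multiply the distance to \<open>a\<close> by at most \<open>1 + R\<close>
and add \<open>D\<close>, and after fewer than \<open>card A\<close> jumps \<open>b\<close> could not be reached. So some gap dominates
what precedes it and is at the same time comparable to the whole diameter. The first property beats
the factor \<open>r * k m\<close> in the exponent of the decorrelation property, the second one beats its polynomial
factor in the length of the second block.\<close>

lemma exists_dominating_gap:
  fixes A :: "nat set" and R :: real
  assumes fin: "finite A" and a: "a \<in> A" and b: "b \<in> A" and "a < b"
    and bounds: "\<And>x. x \<in> A \<Longrightarrow> a \<le> x \<and> x \<le> b" and R: "0 \<le> R"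
  obtains s t where "s \<in> A" "t \<in> A" "s < t" "\<And>x. x \<in> A \<Longrightarrow> x \<le> s \<or> t \<le> x"
    "R * (real s - real a) \<le> real t - real s"
    "real b - real a \<le> (2 + R) ^ card A * (real t - real s)"
proof (rule ccontr)
  assume neg: "\<not> thesis"
  note no_gap = that
  define D where "D = (real b - real a) / (2 + R) ^ card A"
  have D: "0 < D" using \<open>a < b\<close> R by (simp add: D_def)
  have claim: "real t - real a \<le> D * ((2 + R) ^ card {x\<in>A. x < t} - 1)" if "t \<in> A" for t
    using that
  proof (induction t rule: less_induct)
    case (less t)
    show ?case
    proof (cases "t = a")
      case True
      then have empty: "{x\<in>A. x < t} = {}" using bounds by force
      show ?thesis by (simp only: empty) (simp add: True)
    next
      case False
      then have ne: "{x\<in>A. x < t} \<noteq> {}" using bounds[OF less.prems] a by force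
      define s where "s = Max {x\<in>A. x < t}"
      have s: "s \<in> A" "s < t" using Max_in[of "{x\<in>A. x < t}"] fin ne by (auto simp: s_def)
      have sep: "x \<le> s \<or> t \<le> x" if "x \<in> A" for x
        using that fin by (cases "x < t") (auto simp: s_def intro!: Max_ge)
      have "real t - real s < R * (real s - real a) \<or>
            (2 + R) ^ card A * (real t - real s) < real b - real a"
        using neg no_gap[OF s(1) less.prems s(2)] sep by force
      then have step: "real t - real s \<le> R * (real s - real a) + D"
      proof
        assume "(2 + R) ^ card A * (real t - real s) < real b - real a"
        then have "real t - real s < D" using R by (simp add: D_def field_simps)
        moreover have "0 \<le> R * (real s - real a)" using R bounds[OF s(1)] by simp
        ultimately show ?thesis by linarith
      qed (use D in linarith)
      have "{x\<in>A. x < t} = insert s {x\<in>A. x < s}" using s sep by force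
      then have card: "card {x\<in>A. x < t} = Suc (card {x\<in>A. x < s})"
        using fin by simp
      let ?Z = "(2 + R) ^ card {x\<in>A. x < s}"
      have Z: "1 \<le> ?Z" using R by simp
      have "real t - real a \<le> (1 + R) * (real s - real a) + D"
        using step by (simp add: algebra_simps)
      also have "\<dots> \<le> (1 + R) * (D * (?Z - 1)) + D"
        using less.IH[OF s(2) s(1)] R by (intro add_right_mono mult_left_mono) auto
      also have "\<dots> = D * ((1 + R) * (?Z - 1) + 1)" by (simp add: algebra_simps)
      also have "\<dots> \<le> D * ((2 + R) * ?Z - 1)"
      proof (intro mult_left_mono)
        show "(1 + R) * (?Z - 1) + 1 \<le> (2 + R) * ?Z - 1"
          using R Z by (simp only: distrib_right right_diff_distrib)
      qed (use D in simp)
      finally show ?thesis unfolding card by simp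
    qed
  qed
  have "real b - real a \<le> D * ((2 + R) ^ card {x\<in>A. x < b} - 1)" by (rule claim[OF b])
  also have "\<dots> < D * (2 + R) ^ card A"
  proof -
    have "(2 + R) ^ card {x\<in>A. x < b} \<le> (2 + R) ^ card A"
      using R fin by (intro power_increasing card_mono) auto
    then show ?thesis using D by (intro mult_strict_left_mono) auto
  qed
  also have "\<dots> = real b - real a" using R by (simp add: D_def)
  finally show False by simp
qed

section \<open>Decorrelation of products over finite sets of times\<close>

lemma sup_norm_range:
  assumes "\<And>x. norm (f x) \<le> 1"
  shows "0 \<le> sup_norm f" "sup_norm f \<le> 1"
proof -
  have bdd: "bdd_above (range (\<lambda>x. norm (f x)))"
    using assms by (auto intro!: bdd_aboveI)
  show "sup_norm f \<le> 1" unfolding sup_norm_def by (rule cSUP_least) (use assms in auto)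
  have "0 \<le> norm (f undefined)" by simp
  also have "\<dots> \<le> sup_norm f" unfolding sup_norm_def by (rule cSUP_upper[OF _ bdd]) auto
  finally show "0 \<le> sup_norm f" .
qed

lemma holder_const_range:
  assumes "holder_bound \<eta> K f" "0 \<le> K"
  shows "0 \<le> holder_const \<eta> f" "holder_const \<eta> f \<le> K"
proof -
  let ?q = "\<lambda>(x, y). norm (f x - f y) / dist x y powr \<eta>"
  have le: "?q z \<le> K" for z
    using assms by (cases z; cases "fst z = snd z")
      (auto simp: holder_bound_def divide_le_eq)
  have bdd: "bdd_above (range ?q)"
    using le by (intro bdd_aboveI) blast
  show "holder_const \<eta> f \<le> K" unfolding holder_const_def by (rule cSUP_least) (use le in auto)
  have "0 = ?q (undefined, undefined)" by simp
  also have "\<dots> \<le> holder_const \<eta> f" unfolding holder_const_def by (rule cSUP_upper[OF _ bdd]) auto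
  finally show "0 \<le> holder_const \<eta> f" .
qed

lemma bounded_holderI:
  assumes "\<And>x. norm (f x) \<le> 1" "holder_bound \<eta> K f"
  shows "bounded_holder \<eta> f"
  unfolding bounded_holder_def using assms by (auto simp: bounded_iff)

text \<open>Coinciding times turn a product of observables into powers of one observable.\<close>

lemma holder_bound_power:
  fixes f :: "'w::metric_space \<Rightarrow> real"
  assumes "\<And>x. \<bar>f x\<bar> \<le> 1" "holder_bound \<eta> K f"
  shows "holder_bound \<eta> (real c * K) (\<lambda>x. f x ^ c)"
  unfolding holder_bound_def
proof (intro allI)
  fix x y
  have "norm (f x ^ c - f y ^ c) \<le> real c * norm (f x - f y)"
    by (rule norm_power_diff) (use assms(1) in auto)
  also have "\<dots> \<le> real c * (K * dist x y powr \<eta>)"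
    using assms(2) by (intro mult_left_mono) (auto simp: holder_bound_def)
  finally show "norm (f x ^ c - f y ^ c) \<le> real c * K * dist x y powr \<eta>" by simp
qed

lemma poly_mono_nonneg:
  fixes P :: "real poly"
  assumes "\<And>i. 0 \<le> coeff P i" "0 \<le> x" "x \<le> y"
  shows "0 \<le> poly P x" "poly P x \<le> poly P y"
  using assms by (auto simp: poly_altdef intro!: sum_nonneg sum_mono mult_left_mono power_mono)

text \<open>The decorrelation property in the form in which it is used: blocks of times are finite sets rather than
increasing enumerations, and the observables are normalised by \<open>1\<close> in supremum norm, so that the bracket in the
bound collapses to a constant that is affine in the number of factors.\<close>

lemma decorrelation_finite_sets:
  fixes M :: "'w::metric_space measure"
  assumes "decorrelation_property M T \<eta> r"
  obtains P :: "real poly" and \<delta> :: real where "\<And>i. 0 \<le> coeff P i" "0 < \<delta>" "\<delta> < 1"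
    "\<And>A B (u :: nat \<Rightarrow> 'w \<Rightarrow> real) (v :: nat \<Rightarrow> 'w \<Rightarrow> real) n K.
       \<lbrakk>finite A; A \<noteq> {}; finite B; B \<noteq> {}; 0 \<le> K;
        \<And>s w. s \<in> A \<Longrightarrow> \<bar>u s w\<bar> \<le> 1; \<And>s. s \<in> A \<Longrightarrow> holder_bound \<eta> K (u s);
        \<And>s w. s \<in> B \<Longrightarrow> \<bar>v s w\<bar> \<le> 1; \<And>s. s \<in> B \<Longrightarrow> holder_bound \<eta> K (v s)\<rbrakk> \<Longrightarrow>
       \<bar>(\<integral>w. (\<Prod>s\<in>A. u s ((T ^^ s) w)) * (\<Prod>s\<in>B. v s ((T ^^ (n + s)) w)) \<partial>M)
         - (\<integral>w. (\<Prod>s\<in>A. u s ((T ^^ s) w)) \<partial>M) * (\<integral>w. (\<Prod>s\<in>B. v s ((T ^^ (n + s)) w)) \<partial>M)\<bar>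
       \<le> (1 + real (card A + card B) * K) * poly P (real (Max B))
           * \<delta> powr (real n - r * real (Max A))"
proof -
  from assms obtain P :: "real poly" and \<delta> :: real where P: "\<And>i. 0 \<le> coeff P i" and \<delta>: "0 < \<delta>" "\<delta> < 1" and
    dec: "\<And>(m::nat) (m'::nat) (f :: nat \<Rightarrow> 'w \<Rightarrow> complex) (k :: nat \<Rightarrow> nat) (l :: nat \<Rightarrow> nat) (n::nat).
           1 \<le> m \<Longrightarrow> 1 \<le> m' \<Longrightarrow>
           (\<forall>i\<in>{1..m + m'}. bounded_holder \<eta> (f i)) \<Longrightarrow>
           strict_mono_on {1..m} k \<Longrightarrow> strict_mono_on {1..m'} l \<Longrightarrow>
           norm (covar M
                   (\<lambda>\<omega>. \<Prod>i=1..m. f i ((T ^^ k i) \<omega>))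
                   (\<lambda>\<omega>. \<Prod>j=1..m'. f (m + j) ((T ^^ (n + l j)) \<omega>)))
           \<le> ((\<Prod>i=1..m + m'. sup_norm (f i)) +
               (\<Sum>i=1..m + m'. holder_const \<eta> (f i) *
                   (\<Prod>j\<in>{1..m + m'} - {i}. sup_norm (f j))))
             * poly P (real (l m')) * \<delta> powr (real n - r * real (k m))"
    unfolding decorrelation_property_def by blast
  show thesis
  proof (rule that[of P \<delta>])
    fix A B :: "nat set" and u v :: "nat \<Rightarrow> 'w \<Rightarrow> real" and n :: nat and K :: real
    assume A: "finite A" "A \<noteq> {}" and B: "finite B" "B \<noteq> {}" and K: "0 \<le> K"
      and u: "\<And>s w. s \<in> A \<Longrightarrow> \<bar>u s w\<bar> \<le> 1" "\<And>s. s \<in> A \<Longrightarrow> holder_bound \<eta> K (u s)"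
      and v: "\<And>s w. s \<in> B \<Longrightarrow> \<bar>v s w\<bar> \<le> 1" "\<And>s. s \<in> B \<Longrightarrow> holder_bound \<eta> K (v s)"
    have enum: "\<exists>k. bij_betw k {1..card S} S \<and> strict_mono_on {1..card S} k \<and> k (card S) = Max S"
      if S: "finite S" "S \<noteq> {}" for S :: "nat set"
    proof -
      obtain h where h: "bij_betw h {..<card S} S" "strict_mono_on {..<card S} h"
        using ex_bij_betw_strict_mono_card[OF S(1)] by blast
      let ?k = "\<lambda>i. h (i - 1)"
      have bij: "bij_betw ?k {1..card S} S"
      proof -
        have "bij_betw (\<lambda>i::nat. i - 1) {1..card S} {..<card S}"
          by (rule bij_betw_byWitness[where f' = Suc]) auto
        from bij_betw_trans[OF this h(1)] show ?thesis by (simp add: comp_def)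
      qed
      have mono: "strict_mono_on {1..card S} ?k"
      proof (intro strict_mono_onI)
        fix i j assume "i \<in> {1..card S}" "j \<in> {1..card S}" "i < j"
        then have "i - 1 \<in> {..<card S}" "j - 1 \<in> {..<card S}" "i - 1 < j - 1" by auto
        then show "h (i - 1) < h (j - 1)" using h(2) by (blast dest: strict_mono_onD)
      qed
      have "card S \<ge> 1" using S by (simp add: Suc_le_eq card_gt_0_iff)
      then have "?k (card S) \<in> S" using bij by (auto simp: bij_betw_def)
      moreover have "y \<le> ?k (card S)" if "y \<in> S" for y
      proof -
        obtain i where i: "i \<in> {1..card S}" "y = ?k i"
          using bij_betw_imp_surj_on[OF bij] \<open>y \<in> S\<close> by blast
        show ?thesis
        proof (cases "i = card S")
          case False
          then have "i < card S" using i by auto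
          then have "?k i < ?k (card S)" using mono i \<open>card S \<ge> 1\<close> unfolding strict_mono_on_def by (metis atLeastAtMost_iff le_refl)
          then show ?thesis using i by simp
        qed (use i in simp)
      qed
      ultimately have "?k (card S) = Max S" using S by (intro Max_eqI[symmetric]) auto
      with bij mono show ?thesis by blast
    qed
    obtain k where k: "bij_betw k {1..card A} A" "strict_mono_on {1..card A} k" "k (card A) = Max A"
      using enum[OF A] by blast
    obtain l where l: "bij_betw l {1..card B} B" "strict_mono_on {1..card B} l" "l (card B) = Max B"
      using enum[OF B] by blast
    define m m' where "m = card A" and "m' = card B"
    have m: "1 \<le> m" "1 \<le> m'" using A B by (auto simp: m_def m'_def Suc_le_eq card_gt_0_iff)
    define f :: "nat \<Rightarrow> 'w \<Rightarrow> complex" where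
      "f i = (\<lambda>w. complex_of_real (if i \<le> m then u (k i) w else v (l (i - m)) w))" for i
    have kA: "k i \<in> A" if "i \<in> {1..m}" for i using k(1) that by (auto simp: bij_betw_def m_def)
    have lB: "l i \<in> B" if "i \<in> {1..m'}" for i using l(1) that by (auto simp: bij_betw_def m'_def)
    have f1: "norm (f i w) \<le> 1" and f2: "holder_bound \<eta> K (f i)" if i: "i \<in> {1..m + m'}" for i w
    proof -
      have "i \<le> m \<and> k i \<in> A \<or> \<not> i \<le> m \<and> l (i - m) \<in> B"
        using kA[of i] lB[of "i - m"] i by fastforce
      then show "norm (f i w) \<le> 1" "holder_bound \<eta> K (f i)"
        using u v by (auto simp: f_def holder_bound_def simp flip: of_real_diff)
    qed
    have fs: "0 \<le> sup_norm (f i)" "sup_norm (f i) \<le> 1" if "i \<in> {1..m + m'}" for i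
      using sup_norm_range[of "f i"] f1[OF that] by auto
    have prodA: "(\<Prod>i=1..m. f i ((T ^^ k i) w)) = complex_of_real (\<Prod>s\<in>A. u s ((T ^^ s) w))" for w
      using prod.reindex_bij_betw[OF k(1), of "\<lambda>s. u s ((T ^^ s) w)"]
      by (simp add: f_def m_def flip: of_real_prod)
    have prodB: "(\<Prod>j=1..m'. f (m + j) ((T ^^ (n + l j)) w)) =
        complex_of_real (\<Prod>s\<in>B. v s ((T ^^ (n + s)) w))" for w
    proof -
      have "(\<Prod>j=1..m'. f (m + j) ((T ^^ (n + l j)) w)) =
        (\<Prod>j=1..m'. complex_of_real (v (l j) ((T ^^ (n + l j)) w)))"
        by (rule prod.cong) (auto simp: f_def)
      then show ?thesis
        using prod.reindex_bij_betw[OF l(1), of "\<lambda>s. v s ((T ^^ (n + s)) w)"]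
        by (simp add: m'_def flip: of_real_prod)
    qed
    let ?U = "\<lambda>w. \<Prod>s\<in>A. u s ((T ^^ s) w)" and ?V = "\<lambda>w. \<Prod>s\<in>B. v s ((T ^^ (n + s)) w)"
    let ?c = "(\<integral>w. ?U w * ?V w \<partial>M) - (\<integral>w. ?U w \<partial>M) * (\<integral>w. ?V w \<partial>M)"
    have cov: "covar M (\<lambda>w. \<Prod>i=1..m. f i ((T ^^ k i) w)) (\<lambda>w. \<Prod>j=1..m'. f (m + j) ((T ^^ (n + l j)) w))
      = complex_of_real ?c"
      unfolding covar_def prodA prodB by (simp flip: of_real_mult of_real_prod)
    have "norm (complex_of_real ?c) \<le> ((\<Prod>i=1..m + m'. sup_norm (f i)) +
               (\<Sum>i=1..m + m'. holder_const \<eta> (f i) *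
                   (\<Prod>j\<in>{1..m + m'} - {i}. sup_norm (f j))))
             * poly P (real (l m')) * \<delta> powr (real n - r * real (k m))"
      unfolding cov[symmetric]
    proof (rule dec[OF m])
      show "\<forall>i\<in>{1..m + m'}. bounded_holder \<eta> (f i)" using bounded_holderI f1 f2 by metis
    qed (use k l in \<open>simp_all add: m_def m'_def\<close>)
    also have "\<dots> \<le> (1 + real (m + m') * K) * poly P (real (l m')) * \<delta> powr (real n - r * real (k m))"
    proof (intro mult_right_mono add_mono)
      show "0 \<le> poly P (real (l m'))" by (rule poly_mono_nonneg(1)[OF P _ order.refl]) simp
      show "(\<Prod>i=1..m + m'. sup_norm (f i)) \<le> 1"
        by (rule prod_le_1) (use fs in auto)
      have "(\<Sum>i=1..m + m'. holder_const \<eta> (f i) * (\<Prod>j\<in>{1..m + m'} - {i}. sup_norm (f j)))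
        \<le> (\<Sum>i=1..m + m'. K * 1)"
      proof (intro sum_mono mult_mono K)
        fix i assume i: "i \<in> {1..m + m'}"
        show "holder_const \<eta> (f i) \<le> K" by (rule holder_const_range[OF f2[OF i] K])
        show "(\<Prod>j\<in>{1..m + m'} - {i}. sup_norm (f j)) \<le> 1"
          by (rule prod_le_1) (use fs in auto)
        show "0 \<le> (\<Prod>j\<in>{1..m + m'} - {i}. sup_norm (f j))"
          by (rule prod_nonneg) (use fs in auto)
      qed
      then show "(\<Sum>i=1..m + m'. holder_const \<eta> (f i) * (\<Prod>j\<in>{1..m + m'} - {i}. sup_norm (f j)))
        \<le> real (m + m') * K" by simp
    qed auto
    finally show "\<bar>?c\<bar> \<le> (1 + real (card A + card B) * K) * poly P (real (Max B))
           * \<delta> powr (real n - r * real (Max A))"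
      unfolding norm_of_real k(3)[folded m_def] l(3)[folded m'_def] by (simp add: m_def m'_def)
  qed (use P \<delta> in auto)
qed

section \<open>Splitting a correlation at a gap\<close>

lemma measure_preserving_funpow:
  assumes "measure_preserving_map M T"
  shows "measure_preserving_map M (T ^^ n)"
proof (induction n)
  case 0
  show ?case by (simp add: measure_preserving_map_def distr_id2)
next
  case (Suc n)
  then have n: "T ^^ n \<in> measurable M M" "distr M M (T ^^ n) = M"
    by (auto simp: measure_preserving_map_def)
  have T: "T \<in> measurable M M" "distr M M T = M"
    using assms by (auto simp: measure_preserving_map_def)
  have "distr M M (T \<circ> (T ^^ n)) = distr (distr M M (T ^^ n)) M T"
    by (rule distr_distr[symmetric, OF T(1) n(1)])
  then show ?case
    using n T measurable_comp[OF n(1) T(1)] by (simp add: measure_preserving_map_def comp_def)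
qed

text \<open>Used to let one half of an exponential decay absorb the polynomial factor of the decorrelation property.\<close>

lemma poly_times_geometric_bounded:
  fixes P :: "real poly"
  assumes "0 < \<sigma>" "\<sigma> < 1"
  shows "\<exists>C\<ge>0. \<forall>D::nat. poly P (real D) * \<sigma> ^ D \<le> C"
proof -
  have one: "(\<lambda>D. real D ^ i * \<sigma> ^ D) \<longlonglongrightarrow> 0" for i
    using assms
  proof (induction i arbitrary: \<sigma>)
    case 0
    then show ?case by (simp add: LIMSEQ_power_zero)
  next
    case (Suc i)
    define \<tau> where "\<tau> = sqrt \<sigma>"
    have \<tau>: "0 < \<tau>" "\<tau> < 1" "\<sigma> = \<tau> * \<tau>" using Suc.prems by (auto simp: \<tau>_def)
    have "(\<lambda>D. real D * \<tau> ^ D) \<longlonglongrightarrow> 0" using powser_times_n_limit_0[of \<tau>] \<tau> by simp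
    from tendsto_mult[OF this Suc.IH[OF \<tau>(1,2)]]
    show ?case by (simp add: \<tau>(3) power_mult_distrib mult_ac)
  qed
  have "(\<lambda>D. \<Sum>i\<le>degree P. coeff P i * (real D ^ i * \<sigma> ^ D)) \<longlonglongrightarrow> (\<Sum>i\<le>degree P. coeff P i * 0)"
    by (intro tendsto_intros one)
  then have "(\<lambda>D. poly P (real D) * \<sigma> ^ D) \<longlonglongrightarrow> 0"
    by (simp add: poly_altdef sum_distrib_left sum_distrib_right mult_ac)
  then have "Bseq (\<lambda>D. poly P (real D) * \<sigma> ^ D)"
    using convergent_imp_Bseq convergent_def by blast
  then obtain C where C: "0 < C" "\<And>D. \<bar>poly P (real D) * \<sigma> ^ D\<bar> \<le> C"
    by (auto simp: Bseq_def)
  then show ?thesis by (intro exI[of _ C] conjI allI) (auto dest: abs_le_D1)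
qed

definition observable_family ::
  "'w::metric_space measure \<Rightarrow> real \<Rightarrow> real \<Rightarrow> (nat \<Rightarrow> 'w \<Rightarrow> real) \<Rightarrow> bool" where
  "observable_family M \<eta> K g \<longleftrightarrow>
     (\<forall>k. g k \<in> borel_measurable M \<and> (\<forall>w. \<bar>g k w\<bar> \<le> 1) \<and> holder_bound \<eta> K (g k))"

text \<open>A tuple of times is a function \<open>\<phi>\<close> on an index set, neither sorted nor injective. Summing over all tuples then
becomes summing over \<open>PiE\<close>, and a restriction to a block of indices needs no renumbering.\<close>

definition correlation ::
  "'w measure \<Rightarrow> ('w \<Rightarrow> 'w) \<Rightarrow> (nat \<Rightarrow> 'w \<Rightarrow> real) \<Rightarrow> nat set \<Rightarrow> (nat \<Rightarrow> nat) \<Rightarrow> real" where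
  "correlation M T g I \<phi> = (\<integral>w. (\<Prod>i\<in>I. g (\<phi> i) ((T ^^ \<phi> i) w)) \<partial>M)"

lemma abs_prod_le_1:
  fixes f :: "'a \<Rightarrow> real"
  assumes "\<And>i. i \<in> I \<Longrightarrow> \<bar>f i\<bar> \<le> 1"
  shows "\<bar>\<Prod>i\<in>I. f i\<bar> \<le> 1"
  using prod_mono[of I "\<lambda>i. \<bar>f i\<bar>" "\<lambda>_. 1"] assms by (simp add: abs_prod)

text \<open>Grouping equal times: the product over a tuple is a product over the set of its values.\<close>

lemma prod_mult_fibers:
  assumes "finite I"
  shows "(\<Prod>i\<in>I. h (\<phi> i)) = (\<Prod>s\<in>\<phi> ` I. h s ^ card {i\<in>I. \<phi> i = s} :: real)"
proof -
  have "(\<Prod>i\<in>I. h (\<phi> i)) = (\<Prod>s\<in>\<phi> ` I. \<Prod>i\<in>{i\<in>I. \<phi> i = s}. h (\<phi> i))"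
    by (rule prod.image_gen[OF assms])
  also have "\<dots> = (\<Prod>s\<in>\<phi> ` I. h s ^ card {i\<in>I. \<phi> i = s})"
    by (intro prod.cong refl) auto
  finally show ?thesis .
qed

lemma correlation_abs_le_1:
  assumes "prob_space M" "observable_family M \<eta> K g"
  shows "\<bar>correlation M T g I \<phi>\<bar> \<le> 1"
proof -
  interpret prob_space M by fact
  have le: "\<bar>\<Prod>i\<in>I. g (\<phi> i) ((T ^^ \<phi> i) w)\<bar> \<le> 1" for w
    using assms(2) by (intro abs_prod_le_1) (auto simp: observable_family_def)
  have "\<bar>correlation M T g I \<phi>\<bar> \<le> (\<integral>w. \<bar>\<Prod>i\<in>I. g (\<phi> i) ((T ^^ \<phi> i) w)\<bar> \<partial>M)"
    unfolding correlation_def by (rule integral_abs_bound)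
  also have "\<dots> \<le> (\<integral>w. 1 \<partial>M)"
  proof (cases "integrable M (\<lambda>w. \<bar>\<Prod>i\<in>I. g (\<phi> i) ((T ^^ \<phi> i) w)\<bar>)")
    case True
    then show ?thesis using le by (intro integral_mono) auto
  next
    case False
    then show ?thesis by (simp add: not_integrable_integral_eq prob_space)
  qed
  finally show ?thesis by (simp add: prob_space)
qed

lemma correlation_shift:
  assumes mp: "measure_preserving_map M T" and obs: "observable_family M \<eta> K g"
    and fin: "finite I" and a: "\<And>i. i \<in> I \<Longrightarrow> a \<le> \<phi> i"
  shows "correlation M T g I \<phi> = (\<integral>w. (\<Prod>i\<in>I. g (\<phi> i) ((T ^^ (\<phi> i - a)) w)) \<partial>M)"
proof -
  let ?h = "\<lambda>w. \<Prod>i\<in>I. g (\<phi> i) ((T ^^ (\<phi> i - a)) w)"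
  have meas: "T ^^ n \<in> measurable M M" for n
    using measure_preserving_funpow[OF mp] by (auto simp: measure_preserving_map_def)
  have gm: "g k \<in> borel_measurable M" for k using obs by (auto simp: observable_family_def)
  have "?h \<in> borel_measurable M"
    by (intro borel_measurable_prod measurable_compose[OF meas gm])
  then have "integral\<^sup>L (distr M M (T ^^ a)) ?h = (\<integral>w. ?h ((T ^^ a) w) \<partial>M)"
    by (rule integral_distr[OF meas])
  moreover have "distr M M (T ^^ a) = M"
    using measure_preserving_funpow[OF mp] by (auto simp: measure_preserving_map_def)
  moreover have "?h ((T ^^ a) w) = (\<Prod>i\<in>I. g (\<phi> i) ((T ^^ \<phi> i) w))" for w
  proof (intro prod.cong refl)
    fix i assume "i \<in> I"
    then have "\<phi> i - a + a = \<phi> i" using a by simp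
    then show "g (\<phi> i) ((T ^^ (\<phi> i - a)) ((T ^^ a) w)) = g (\<phi> i) ((T ^^ \<phi> i) w)"
      by (metis comp_apply funpow_add)
  qed
  ultimately show ?thesis unfolding correlation_def by simp
qed

text \<open>The tuple is cut at a dominating gap, from \<open>s\<close> to \<open>t\<close>, of its set of values: \<open>J\<close> consists of the indices with
times up to \<open>s\<close>. After a shift by the smallest time \<open>a\<close>, the decorrelation property with \<open>n = t - a\<close> has exponent
\<open>(t - a) - r (s - a)\<close>, which is at least half of the gap as soon as \<open>R = 2 r\<close>; and the gap is at least \<open>c\<close> times
the diameter of the tuple.\<close>

lemma correlation_splitting:
  fixes M :: "'w::metric_space measure" and q :: nat
  assumes M: "prob_space M" and mp: "measure_preserving_map M T"
    and dec: "decorrelation_property M T \<eta> r" and r: "1 \<le> r" and K: "0 \<le> K"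
  shows "\<exists>C \<theta> :: real. 0 \<le> C \<and> 0 < \<theta> \<and> \<theta> < 1 \<and>
    (\<forall>g I \<phi>. observable_family M \<eta> K g \<and> finite I \<and> card I = q \<and> 2 \<le> q \<longrightarrow>
      (\<exists>J. J \<subset> I \<and> J \<noteq> {} \<and>
        \<bar>correlation M T g I \<phi> - correlation M T g J \<phi> * correlation M T g (I - J) \<phi>\<bar>
          \<le> C * \<theta> ^ (Max (\<phi> ` I) - Min (\<phi> ` I))))"
proof (rule decorrelation_finite_sets[OF dec])
  fix P :: "real poly" and \<delta> :: real
  assume P: "\<And>i. 0 \<le> coeff P i" and \<delta>: "0 < \<delta>" "\<delta> < 1" and cov:
    "\<And>A B (u :: nat \<Rightarrow> 'w \<Rightarrow> real) (v :: nat \<Rightarrow> 'w \<Rightarrow> real) n K.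
       \<lbrakk>finite A; A \<noteq> {}; finite B; B \<noteq> {}; 0 \<le> K;
        \<And>s w. s \<in> A \<Longrightarrow> \<bar>u s w\<bar> \<le> 1; \<And>s. s \<in> A \<Longrightarrow> holder_bound \<eta> K (u s);
        \<And>s w. s \<in> B \<Longrightarrow> \<bar>v s w\<bar> \<le> 1; \<And>s. s \<in> B \<Longrightarrow> holder_bound \<eta> K (v s)\<rbrakk> \<Longrightarrow>
       \<bar>(\<integral>w. (\<Prod>s\<in>A. u s ((T ^^ s) w)) * (\<Prod>s\<in>B. v s ((T ^^ (n + s)) w)) \<partial>M)
         - (\<integral>w. (\<Prod>s\<in>A. u s ((T ^^ s) w)) \<partial>M) * (\<integral>w. (\<Prod>s\<in>B. v s ((T ^^ (n + s)) w)) \<partial>M)\<bar>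
       \<le> (1 + real (card A + card B) * K) * poly P (real (Max B))
           * \<delta> powr (real n - r * real (Max A))"
  define R where "R = 2 * r"
  define c where "c = 1 / (2 + R) ^ q"
  have R: "0 \<le> R" and c: "0 < c" using r by (auto simp: R_def c_def)
  \<comment> \<open>The exponent will be at least \<open>c * D / 2\<close> with \<open>D\<close> the diameter. Half of this is kept,
      the other half is spent on the polynomial factor.\<close>
  define \<theta> where "\<theta> = \<delta> powr (c / 4)"
  have \<theta>: "0 < \<theta>" "\<theta> < 1" using \<delta> c by (auto simp: \<theta>_def powr_def mult_less_0_iff)
  obtain C1 where C1: "0 \<le> C1" "\<And>D::nat. poly P (real D) * \<theta> ^ D \<le> C1"
    using poly_times_geometric_bounded[OF \<theta>] by metis
  define L where "L = 1 + 2 * real q * (real q * K)"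
  have L: "1 \<le> L" using K by (simp add: L_def)
  show ?thesis
  proof (rule exI[of _ "2 + L * C1"], rule exI[of _ \<theta>], intro conjI allI impI, goal_cases)
    case 1
    show ?case using L C1 by simp
  next
    case (4 g I \<phi>)
    then have obs: "observable_family M \<eta> K g" and fin: "finite I" and q: "card I = q" "2 \<le> q"
      by auto
    have ne: "I \<noteq> {}" using q by auto
    define a b where "a = Min (\<phi> ` I)" and "b = Max (\<phi> ` I)"
    have ab: "a \<in> \<phi> ` I" "b \<in> \<phi> ` I" "\<And>x. x \<in> \<phi> ` I \<Longrightarrow> a \<le> x \<and> x \<le> b"
      using fin ne by (auto simp: a_def b_def)
    show ?case
    proof (cases "a = b")
      case True
      \<comment> \<open>All times agree, the geometric factor is \<open>\<theta> ^ 0\<close>, and this is what the summand \<open>2\<close> of the constant is for.\<close>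
      obtain i where i: "i \<in> I" using ne by auto
      have "{i} \<noteq> I" using q by auto
      let ?E = "\<lambda>J. correlation M T g J \<phi>"
      have "\<bar>?E I - ?E {i} * ?E (I - {i})\<bar> \<le> \<bar>?E I\<bar> + \<bar>?E {i}\<bar> * \<bar>?E (I - {i})\<bar>"
        by (simp flip: abs_mult)
      also have "\<dots> \<le> 1 + 1 * 1"
        by (intro add_mono mult_mono correlation_abs_le_1[OF M obs]) auto
      also have "\<dots> \<le> 2 + L * C1" using L C1 by simp
      finally show ?thesis using i \<open>{i} \<noteq> I\<close> True
        by (intro exI[of _ "{i}"]) (auto simp flip: a_def b_def)
    next
      case False
      then have "a < b" using ab by (metis nat_less_le)
      obtain s t where st: "s \<in> \<phi> ` I" "t \<in> \<phi> ` I" "s < t" "\<And>x. x \<in> \<phi> ` I \<Longrightarrow> x \<le> s \<or> t \<le> x"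
        "R * (real s - real a) \<le> real t - real s"
        "real b - real a \<le> (2 + R) ^ card (\<phi> ` I) * (real t - real s)"
        using exists_dominating_gap[OF _ ab(1,2) \<open>a < b\<close> ab(3) R] fin by (metis finite_imageI)
      define D where "D = b - a"
      have gap: "c * real D \<le> real t - real s"
      proof -
        have "real b - real a \<le> (2 + R) ^ q * (real t - real s)"
          using st(3,6) R card_image_le[OF fin, of \<phi>] unfolding q
          by (elim order_trans) (intro mult_right_mono power_increasing, auto)
        then show ?thesis using R \<open>a < b\<close> by (simp add: c_def D_def field_simps)
      qed
      define J where "J = {i\<in>I. \<phi> i \<le> s}"
      have J: "J \<subset> I" "J \<noteq> {}" "finite J" "finite (I - J)" "I - J \<noteq> {}"
      proof -
        obtain i j where ij: "i \<in> I" "\<phi> i = s" "j \<in> I" "\<phi> j = t" using st(1,2) by blast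
        then have "i \<in> J" "j \<in> I - J" using st(3) by (auto simp: J_def)
        then show "J \<subset> I" "J \<noteq> {}" "I - J \<noteq> {}" by (auto simp: J_def)
        show "finite J" "finite (I - J)" using fin by (auto simp: J_def)
      qed
      define A B where "A = (\<lambda>i. \<phi> i - a) ` J" and "B = (\<lambda>i. \<phi> i - t) ` (I - J)"
      have tB: "t \<le> \<phi> i" if "i \<in> I - J" for i using that st(4)[of "\<phi> i"] by (auto simp: J_def)
      have aI: "a \<le> \<phi> i" if "i \<in> I" for i using that ab(3) by auto
      \<comment> \<open>Multiplicities with which the values occur in the two blocks.\<close>
      define mA mB where "mA x = card {i\<in>J. \<phi> i - a = x}" and "mB x = card {i\<in>I - J. \<phi> i - t = x}" for x
      define u v where "u x = (\<lambda>w. g (x + a) w ^ mA x)" and "v x = (\<lambda>w. g (x + t) w ^ mB x)" for x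
      have AB: "finite A" "A \<noteq> {}" "finite B" "B \<noteq> {}" using J by (auto simp: A_def B_def)
      have mq: "mA x \<le> q" "mB x \<le> q" for x
        using J fin by (auto simp: mA_def mB_def simp flip: q(1) intro!: card_mono)
      have g: "\<bar>g k w\<bar> \<le> 1" "holder_bound \<eta> K (g k)" for k w
        using obs by (auto simp: observable_family_def)
      have hp: "holder_bound \<eta> (real q * K) (\<lambda>w. g k w ^ m)" if "m \<le> q" for k m
      proof -
        have "holder_bound \<eta> (real m * K) (\<lambda>w. g k w ^ m)" by (rule holder_bound_power[OF g])
        moreover have "real m * K * dist x y powr \<eta> \<le> real q * K * dist x y powr \<eta>" for x y :: 'w
          using that K by (intro mult_right_mono) auto
        ultimately show ?thesis unfolding holder_bound_def by (blast intro: order_trans)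
      qed
      have uv: "\<bar>u x w\<bar> \<le> 1" "holder_bound \<eta> (real q * K) (u x)"
        "\<bar>v x w\<bar> \<le> 1" "holder_bound \<eta> (real q * K) (v x)" for x w
        using hp[OF mq(1)] hp[OF mq(2)] g by (auto simp: u_def v_def power_abs power_le_one)
      have pJ: "(\<Prod>x\<in>A. u x ((T ^^ x) w)) = (\<Prod>i\<in>J. g (\<phi> i) ((T ^^ (\<phi> i - a)) w))" for w
      proof -
        have "(\<Prod>i\<in>J. g (\<phi> i) ((T ^^ (\<phi> i - a)) w)) =
          (\<Prod>i\<in>J. g ((\<phi> i - a) + a) ((T ^^ (\<phi> i - a)) w))"
          using aI J by (intro prod.cong refl) auto
        also have "\<dots> = (\<Prod>x\<in>A. g (x + a) ((T ^^ x) w) ^ mA x)"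
          unfolding A_def mA_def
          using prod_mult_fibers[OF J(3), of "\<lambda>x. g (x + a) ((T ^^ x) w)" "\<lambda>i. \<phi> i - a"] by simp
        finally show ?thesis by (simp add: u_def)
      qed
      have pJ': "(\<Prod>x\<in>B. v x ((T ^^ ((t - a) + x)) w)) = (\<Prod>i\<in>I - J. g (\<phi> i) ((T ^^ (\<phi> i - a)) w))" for w
      proof -
        have "a \<le> t" using ab(3) st(2) by auto
        have "(\<Prod>i\<in>I - J. g (\<phi> i) ((T ^^ (\<phi> i - a)) w)) =
          (\<Prod>i\<in>I - J. g ((\<phi> i - t) + t) ((T ^^ ((t - a) + (\<phi> i - t))) w))"
        proof (intro prod.cong refl)
          fix i assume "i \<in> I - J"
          then have "\<phi> i - t + t = \<phi> i" "(t - a) + (\<phi> i - t) = \<phi> i - a" using tB \<open>a \<le> t\<close> by force+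
          then show "g (\<phi> i) ((T ^^ (\<phi> i - a)) w) = g ((\<phi> i - t) + t) ((T ^^ ((t - a) + (\<phi> i - t))) w)"
            by presburger
        qed
        also have "\<dots> = (\<Prod>x\<in>B. g (x + t) ((T ^^ ((t - a) + x)) w) ^ mB x)"
          unfolding B_def mB_def
          using prod_mult_fibers[OF J(4), of "\<lambda>x. g (x + t) ((T ^^ ((t - a) + x)) w)" "\<lambda>i. \<phi> i - t"] by simp
        finally show ?thesis by (simp add: v_def)
      qed
      have pI: "(\<Prod>i\<in>I. h i) = (\<Prod>i\<in>J. h i) * (\<Prod>i\<in>I - J. h i)" for h :: "nat \<Rightarrow> real"
        using J fin by (metis prod.subset_diff mult.commute psubset_imp_subset)
      have "Max A = s - a"
      proof (rule Max_eqI)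
        show "finite A" by (rule AB)
        show "s - a \<in> A" using st(1) by (auto simp: A_def J_def)
        show "y \<le> s - a" if "y \<in> A" for y using that by (auto simp: A_def J_def)
      qed
      have "Max B \<le> D"
      proof -
        obtain i where "i \<in> I" "Max B = \<phi> i - t" using Max_in[OF AB(3,4)] by (auto simp: B_def)
        then show ?thesis using ab(3)[of "\<phi> i"] ab(3)[OF st(2)] unfolding D_def by (metis diff_le_mono diff_le_mono2 imageI le_trans)
      qed
      have "\<bar>correlation M T g I \<phi> - correlation M T g J \<phi> * correlation M T g (I - J) \<phi>\<bar>
        \<le> (1 + real (card A + card B) * (real q * K)) * poly P (real (Max B))
           * \<delta> powr (real (t - a) - r * real (Max A))"
      proof -
        have "correlation M T g I \<phi> =
          (\<integral>w. (\<Prod>x\<in>A. u x ((T ^^ x) w)) * (\<Prod>x\<in>B. v x ((T ^^ ((t - a) + x)) w)) \<partial>M)"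
          unfolding pJ pJ' using correlation_shift[OF mp obs fin aI] pI by simp
        moreover have "correlation M T g J \<phi> = (\<integral>w. (\<Prod>x\<in>A. u x ((T ^^ x) w)) \<partial>M)"
          unfolding pJ using correlation_shift[OF mp obs J(3)] aI J(1) by blast
        moreover have "correlation M T g (I - J) \<phi> = (\<integral>w. (\<Prod>x\<in>B. v x ((T ^^ ((t - a) + x)) w)) \<partial>M)"
          unfolding pJ' using correlation_shift[OF mp obs J(4)] aI by blast
        ultimately show ?thesis
          using cov[OF AB, of "real q * K" u v "t - a"] uv K by simp
      qed
      also have "\<dots> \<le> L * poly P (real D) * \<delta> powr (c * real D / 2)"
      proof (intro mult_mono)
        have "card A + card B \<le> 2 * q"
          using card_image_le[OF J(3), of "\<lambda>i. \<phi> i - a"] card_image_le[OF J(4), of "\<lambda>i. \<phi> i - t"]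
            card_mono[OF fin, of J] card_mono[OF fin, of "I - J"] J(1) q by (auto simp: A_def B_def)
        then have "real (card A + card B) \<le> 2 * real q" by linarith
        then show "1 + real (card A + card B) * (real q * K) \<le> L"
          unfolding L_def using K by (intro add_left_mono mult_right_mono) auto
        show "poly P (real (Max B)) \<le> poly P (real D)"
          using \<open>Max B \<le> D\<close> by (intro poly_mono_nonneg[OF P]) auto
        have sa: "a \<le> s" using ab(3) st(1) by auto
        have "r * (real s - real a) \<le> (real t - real s) / 2" using st(5) by (simp add: R_def)
        then have "c * real D / 2 \<le> real (t - a) - r * real (Max A)"
          using gap sa st(3) \<open>Max A = s - a\<close> by simp
        then show "\<delta> powr (real (t - a) - r * real (Max A)) \<le> \<delta> powr (c * real D / 2)"
          using \<delta> by (intro powr_mono') auto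
      qed (use L poly_mono_nonneg(1)[OF P _ order.refl] in auto)
      also have "\<delta> powr (c * real D / 2) = \<theta> ^ D * \<theta> ^ D"
        using \<delta> by (simp add: \<theta>_def powr_powr mult_ac flip: powr_realpow powr_add)
      also have "L * poly P (real D) * (\<theta> ^ D * \<theta> ^ D) = L * (poly P (real D) * \<theta> ^ D) * \<theta> ^ D"
        by simp
      also have "\<dots> \<le> (2 + L * C1) * \<theta> ^ D"
      proof (intro mult_right_mono)
        have "L * (poly P (real D) * \<theta> ^ D) \<le> L * C1" using C1(2) L by (intro mult_left_mono) auto
        then show "L * (poly P (real D) * \<theta> ^ D) \<le> 2 + L * C1" by linarith
      qed (use \<theta> in simp)
      finally show ?thesis using J by (intro exI[of _ J]) (auto simp: D_def a_def b_def)
    qed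
  qed (use \<theta> in auto)
qed

section \<open>Moments of sums along an orbit\<close>

lemma sum_geometric_distance:
  fixes \<tau> :: real
  assumes \<tau>: "0 < \<tau>" "\<tau> < 1" and V: "finite V"
  shows "(\<Sum>v\<in>V. \<tau> ^ ((v - u) + (u - v))) \<le> 2 / (1 - \<tau>)"
proof -
  have one: "(\<Sum>d\<in>D. \<tau> ^ d) \<le> 1 / (1 - \<tau>)" if "finite D" for D :: "nat set"
    using sum_le_suminf[OF summable_geometric that, of \<tau>] suminf_geometric[of \<tau>] \<tau> by simp
  have "(\<Sum>v\<in>V. \<tau> ^ ((v - u) + (u - v))) =
      (\<Sum>v\<in>V \<inter> {u..}. \<tau> ^ ((v - u) + (u - v))) + (\<Sum>v\<in>V \<inter> {..<u}. \<tau> ^ ((v - u) + (u - v)))"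
    using V by (subst sum.union_disjoint[symmetric]) (auto intro!: sum.cong)
  also have "(\<Sum>v\<in>V \<inter> {u..}. \<tau> ^ ((v - u) + (u - v))) = (\<Sum>d\<in>(\<lambda>v. v - u) ` (V \<inter> {u..}). \<tau> ^ d)"
    by (subst sum.reindex) (auto simp: inj_on_def intro!: sum.cong)
  also have "(\<Sum>v\<in>V \<inter> {..<u}. \<tau> ^ ((v - u) + (u - v))) = (\<Sum>d\<in>(\<lambda>v. u - v) ` (V \<inter> {..<u}). \<tau> ^ d)"
    by (subst sum.reindex) (auto simp: inj_on_def intro!: sum.cong)
  finally show ?thesis
    using one[of "(\<lambda>v. v - u) ` (V \<inter> {u..})"] one[of "(\<lambda>v. u - v) ` (V \<inter> {..<u})"] V by simp
qed

text \<open>Exponential decay in the diameter leaves, up to a constant, one free time among \<open>card I\<close>. The diameter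
dominates all distances to one value \<open>u\<close> of \<open>\<phi>\<close>, so the summand is at most a product of
geometric weights around \<open>u\<close>; allowing \<open>u\<close> to be any point of \<open>V\<close> makes the sum over tuples factorise.\<close>

lemma sum_geometric_diameter:
  fixes \<tau> :: real and V I :: "nat set"
  assumes \<tau>: "0 < \<tau>" "\<tau> < 1" and V: "finite V" and I: "finite I" "I \<noteq> {}"
  shows "(\<Sum>\<phi>\<in>PiE I (\<lambda>_. V). (\<tau> ^ card I) ^ (Max (\<phi> ` I) - Min (\<phi> ` I)))
    \<le> real (card V) * (2 / (1 - \<tau>)) ^ card I"
proof -
  let ?h = "\<lambda>u v. \<tau> ^ ((v - u) + (u - v)) :: real"
  have le: "(\<tau> ^ card I) ^ (Max (\<phi> ` I) - Min (\<phi> ` I)) \<le> (\<Sum>u\<in>V. \<Prod>i\<in>I. ?h u (\<phi> i))"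
    if \<phi>: "\<phi> \<in> PiE I (\<lambda>_. V)" for \<phi>
  proof -
    obtain i0 where i0: "i0 \<in> I" using I by auto
    let ?D = "Max (\<phi> ` I) - Min (\<phi> ` I)"
    have d: "(\<phi> i - \<phi> i0) + (\<phi> i0 - \<phi> i) \<le> ?D" if "i \<in> I" for i
    proof -
      have "\<phi> j \<le> Max (\<phi> ` I) \<and> Min (\<phi> ` I) \<le> \<phi> j" if "j \<in> I" for j using that I by auto
      from this[OF that] this[OF i0] show ?thesis by arith
    qed
    have "(\<tau> ^ card I) ^ ?D = (\<Prod>i\<in>I. \<tau> ^ ?D)"
      by (simp add: mult.commute flip: power_mult)
    also have "\<dots> \<le> (\<Prod>i\<in>I. ?h (\<phi> i0) (\<phi> i))"
      using \<tau> d by (intro prod_mono) (auto intro!: power_decreasing)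
    also have "\<dots> \<le> (\<Sum>u\<in>V. \<Prod>i\<in>I. ?h u (\<phi> i))"
      using \<phi> i0 V \<tau>
      by (intro member_le_sum[where f = "\<lambda>u. \<Prod>i\<in>I. ?h u (\<phi> i)"]) (auto intro!: prod_nonneg)
    finally show ?thesis .
  qed
  have "(\<Sum>\<phi>\<in>PiE I (\<lambda>_. V). (\<tau> ^ card I) ^ (Max (\<phi> ` I) - Min (\<phi> ` I)))
    \<le> (\<Sum>\<phi>\<in>PiE I (\<lambda>_. V). \<Sum>u\<in>V. \<Prod>i\<in>I. ?h u (\<phi> i))"
    by (rule sum_mono[OF le])
  also have "\<dots> = (\<Sum>u\<in>V. \<Sum>\<phi>\<in>PiE I (\<lambda>_. V). \<Prod>i\<in>I. ?h u (\<phi> i))" by (rule sum.swap)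
  also have "\<dots> = (\<Sum>u\<in>V. \<Prod>i\<in>I. \<Sum>v\<in>V. ?h u v)"
    by (intro sum.cong refl prod_sum_PiE[symmetric] I V)
  also have "\<dots> \<le> (\<Sum>u\<in>V. \<Prod>i\<in>I. 2 / (1 - \<tau>))"
    using \<tau> sum_geometric_distance[OF \<tau> V]
    by (intro sum_mono prod_mono) (auto intro!: sum_nonneg)
  finally show ?thesis by simp
qed

lemma sum_PiE_mult_split:
  fixes a b :: "('i \<Rightarrow> 'v) \<Rightarrow> real"
  assumes J: "J \<subseteq> I"
    and a: "\<And>\<phi> \<psi>. (\<And>i. i \<in> J \<Longrightarrow> \<phi> i = \<psi> i) \<Longrightarrow> a \<phi> = a \<psi>"
    and b: "\<And>\<phi> \<psi>. (\<And>i. i \<in> I - J \<Longrightarrow> \<phi> i = \<psi> i) \<Longrightarrow> b \<phi> = b \<psi>"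
  shows "(\<Sum>\<phi>\<in>PiE I (\<lambda>_. V). a \<phi> * b \<phi>) =
    (\<Sum>\<phi>\<in>PiE J (\<lambda>_. V). a \<phi>) * (\<Sum>\<phi>\<in>PiE (I - J) (\<lambda>_. V). b \<phi>)"
proof -
  have "(\<Sum>\<phi>\<in>PiE I (\<lambda>_. V). a \<phi> * b \<phi>) =
    (\<Sum>(x, y)\<in>PiE J (\<lambda>_. V) \<times> PiE (I - J) (\<lambda>_. V). a x * b y)"
  proof (rule sum.reindex_bij_witness[where
      i = "\<lambda>(x, y) i. if i \<in> J then x i else y i" and
      j = "\<lambda>\<phi>. (restrict \<phi> J, restrict \<phi> (I - J))"], goal_cases)
    case (1 \<phi>)
    then show ?case using J by (auto simp: fun_eq_iff PiE_def extensional_def)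
  next
    case (2 \<phi>)
    then show ?case using J by auto
  next
    case (3 z)
    then show ?case using J by (cases z) (auto simp: fun_eq_iff PiE_def extensional_def)
  next
    case (4 z)
    then show ?case using J by (cases z) (auto simp: PiE_def extensional_def Pi_def)
  next
    case (5 \<phi>)
    have "a (restrict \<phi> J) = a \<phi>" "b (restrict \<phi> (I - J)) = b \<phi>" by (auto intro: a b)
    then show ?case by simp
  qed
  then show ?thesis by (simp add: sum_product sum.cartesian_product)
qed

text \<open>The number of tuples is \<open>card V ^ card I\<close>, but up to a constant their correlations add up only to its square root. By induction
on the length: splitting costs a sum bounded by a multiple of \<open>card V\<close>, which is harmless
for length at least \<open>2\<close>, and the products that remain factorise over the two shorter blocks. Length \<open>1\<close>
contributes nothing because the observables are centred.\<close>

lemma sum_correlation_bound: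
  fixes M :: "'w::metric_space measure" and q :: nat
  assumes M: "prob_space M" and mp: "measure_preserving_map M T"
    and dec: "decorrelation_property M T \<eta> r" and r: "1 \<le> r" and K: "0 \<le> K"
  shows "\<exists>C\<ge>0. \<forall>g I V. observable_family M \<eta> K g \<and> (\<forall>k. (\<integral>w. g k w \<partial>M) = 0) \<and>
      finite I \<and> I \<noteq> {} \<and> card I \<le> q \<and> finite V \<and> V \<noteq> {} \<longrightarrow>
      (\<Sum>\<phi>\<in>PiE I (\<lambda>_. V). \<bar>correlation M T g I \<phi>\<bar>) \<le> C * sqrt (real (card V)) ^ card I"
proof (induction q)
  case 0
  show ?case by (intro exI[of _ 0]) auto
next
  case (Suc q)
  obtain C0 where C0_nonneg: "0 \<le> C0" and C0_all:
    "\<forall>g I V. observable_family M \<eta> K g \<and> (\<forall>k. (\<integral>w. g k w \<partial>M) = 0) \<and>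
      finite I \<and> I \<noteq> {} \<and> card I \<le> q \<and> finite V \<and> V \<noteq> {} \<longrightarrow>
      (\<Sum>\<phi>\<in>PiE I (\<lambda>_. V). \<bar>correlation M T g I \<phi>\<bar>) \<le> C0 * sqrt (real (card V)) ^ card I"
    using Suc.IH by (elim exE conjE) (rule that)
  obtain C1 \<theta> where C1: "0 \<le> C1" and \<theta>: "0 < \<theta>" "\<theta> < 1" and split:
    "\<forall>g I \<phi>. observable_family M \<eta> K g \<and> finite I \<and> card I = Suc q \<and> 2 \<le> Suc q \<longrightarrow>
      (\<exists>J. J \<subset> I \<and> J \<noteq> {} \<and>
        \<bar>correlation M T g I \<phi> - correlation M T g J \<phi> * correlation M T g (I - J) \<phi>\<bar>
          \<le> C1 * \<theta> ^ (Max (\<phi> ` I) - Min (\<phi> ` I)))"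
    using correlation_splitting[OF M mp dec r K, of "Suc q"] by (elim exE conjE) (rule that)
  \<comment> \<open>The decay in the diameter is shared among the \<open>Suc q\<close> indices.\<close>
  define \<tau> where "\<tau> = root (Suc q) \<theta>"
  have \<tau>: "0 < \<tau>" "\<tau> < 1" "\<tau> ^ Suc q = \<theta>"
    using \<theta> real_root_less_iff[of "Suc q" \<theta> 1] by (auto simp: \<tau>_def simp del: power_Suc)
  define G where "G = C1 * (2 / (1 - \<tau>)) ^ Suc q"
  have G: "0 \<le> G" using C1 \<tau> by (simp add: G_def)
  define C where "C = C0 + G + 2 ^ Suc q * C0\<^sup>2"
  have C: "0 \<le> C" "C0 \<le> C" "G + 2 ^ Suc q * C0\<^sup>2 \<le> C" using C0_nonneg G by (auto simp: C_def)
  show ?case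
  proof (intro exI[of _ C] conjI allI impI C(1), elim conjE)
    fix g and I V :: "nat set"
    assume g: "observable_family M \<eta> K g" "\<forall>k. (\<integral>w. g k w \<partial>M) = 0"
      and I: "finite I" "I \<noteq> {}" "card I \<le> Suc q" and V: "finite V" "V \<noteq> {}"
    have C0: "(\<Sum>\<phi>\<in>PiE I (\<lambda>_. V). \<bar>correlation M T g I \<phi>\<bar>) \<le> C0 * sqrt (real (card V)) ^ card I"
      if "finite I" "I \<noteq> {}" "card I \<le> q" for I
      by (rule C0_all[rule_format], intro conjI) (fact g that V)+
    let ?E = "correlation M T g" and ?s = "sqrt (real (card V))"
    have s: "1 \<le> ?s" using V by (simp add: Suc_le_eq card_gt_0_iff)
    consider "card I \<le> q" | "card I = 1" | "card I = Suc q" "2 \<le> Suc q"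
      using I by linarith
    then show "(\<Sum>\<phi>\<in>PiE I (\<lambda>_. V). \<bar>?E I \<phi>\<bar>) \<le> C * ?s ^ card I"
    proof cases
      case 1
      have "(\<Sum>\<phi>\<in>PiE I (\<lambda>_. V). \<bar>?E I \<phi>\<bar>) \<le> C0 * ?s ^ card I"
        by (rule C0[OF I(1,2) 1])
      also have "\<dots> \<le> C * ?s ^ card I" using C s by (intro mult_right_mono) auto
      finally show ?thesis .
    next
      case 2
      then obtain i where i: "I = {i}" by (auto simp: card_1_singleton_iff)
      have "?E I \<phi> = 0" for \<phi>
        using correlation_shift[OF mp g(1) I(1), of "\<phi> i" \<phi>] g(2) by (simp add: i)
      then show ?thesis using C s by simp
    next
      case 3
      define \<J> where "\<J> = {J. J \<subset> I \<and> J \<noteq> {}}"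
      have fin\<J>: "finite \<J>" and card\<J>: "card \<J> \<le> 2 ^ Suc q"
      proof -
        have sub: "\<J> \<subseteq> Pow I" by (auto simp: \<J>_def)
        show "finite \<J>" by (rule finite_subset[OF sub]) (use I in auto)
        show "card \<J> \<le> 2 ^ Suc q"
          using card_mono[OF _ sub] I 3 by (simp add: card_Pow del: power_Suc)
      qed
      have pt: "\<bar>?E I \<phi>\<bar> \<le> C1 * \<theta> ^ (Max (\<phi> ` I) - Min (\<phi> ` I)) +
          (\<Sum>J\<in>\<J>. \<bar>?E J \<phi>\<bar> * \<bar>?E (I - J) \<phi>\<bar>)" for \<phi>
      proof -
        obtain J where J: "J \<in> \<J>" "\<bar>?E I \<phi> - ?E J \<phi> * ?E (I - J) \<phi>\<bar>
            \<le> C1 * \<theta> ^ (Max (\<phi> ` I) - Min (\<phi> ` I))"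
          using split[rule_format, of g I \<phi>] g(1) I(1) 3 unfolding \<J>_def by blast
        have "\<bar>?E J \<phi>\<bar> * \<bar>?E (I - J) \<phi>\<bar> \<le> (\<Sum>J\<in>\<J>. \<bar>?E J \<phi>\<bar> * \<bar>?E (I - J) \<phi>\<bar>)"
          using J fin\<J> by (intro member_le_sum[where f = "\<lambda>J. \<bar>?E J \<phi>\<bar> * \<bar>?E (I - J) \<phi>\<bar>"]) auto
        moreover have "\<bar>?E I \<phi>\<bar> \<le> \<bar>?E I \<phi> - ?E J \<phi> * ?E (I - J) \<phi>\<bar> + \<bar>?E J \<phi>\<bar> * \<bar>?E (I - J) \<phi>\<bar>"
          unfolding abs_mult[symmetric] by linarith
        ultimately show ?thesis using J(2) by linarith
      qed
      have block: "(\<Sum>\<phi>\<in>PiE I (\<lambda>_. V). \<bar>?E J \<phi>\<bar> * \<bar>?E (I - J) \<phi>\<bar>) \<le> C0\<^sup>2 * ?s ^ Suc q"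
        if "J \<in> \<J>" for J
      proof -
        have J: "J \<subset> I" "J \<noteq> {}" "I - J \<noteq> {}" "finite J" "finite (I - J)"
          using that I finite_subset by (auto simp: \<J>_def)
        have cJ: "card J + card (I - J) = Suc q"
          using J I 3 by (metis card_Diff_subset card_mono le_add_diff_inverse psubset_imp_subset)
        have "0 < card J" "0 < card (I - J)" using J by (auto simp: card_gt_0_iff)
        with cJ have cq: "card J \<le> q" "card (I - J) \<le> q" by linarith+
        have "(\<Sum>\<phi>\<in>PiE I (\<lambda>_. V). \<bar>?E J \<phi>\<bar> * \<bar>?E (I - J) \<phi>\<bar>) =
          (\<Sum>\<phi>\<in>PiE J (\<lambda>_. V). \<bar>?E J \<phi>\<bar>) * (\<Sum>\<phi>\<in>PiE (I - J) (\<lambda>_. V). \<bar>?E (I - J) \<phi>\<bar>)"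
          using J(1) by (intro sum_PiE_mult_split) (auto simp: correlation_def)
        also have "\<dots> \<le> (C0 * ?s ^ card J) * (C0 * ?s ^ card (I - J))"
          using C0[OF J(4,2) cq(1)] C0[OF J(5,3) cq(2)] C0_nonneg s
          by (intro mult_mono) (auto intro!: sum_nonneg)
        also have "\<dots> = C0\<^sup>2 * ?s ^ Suc q"
          unfolding cJ[symmetric] by (simp add: power_add power2_eq_square)
        finally show ?thesis .
      qed
      have "(\<Sum>\<phi>\<in>PiE I (\<lambda>_. V). \<bar>?E I \<phi>\<bar>) \<le>
          (\<Sum>\<phi>\<in>PiE I (\<lambda>_. V). C1 * \<theta> ^ (Max (\<phi> ` I) - Min (\<phi> ` I)) +
          (\<Sum>J\<in>\<J>. \<bar>?E J \<phi>\<bar> * \<bar>?E (I - J) \<phi>\<bar>))"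
        by (rule sum_mono[OF pt])
      also have "\<dots> = C1 * (\<Sum>\<phi>\<in>PiE I (\<lambda>_. V). \<theta> ^ (Max (\<phi> ` I) - Min (\<phi> ` I))) +
          (\<Sum>J\<in>\<J>. \<Sum>\<phi>\<in>PiE I (\<lambda>_. V). \<bar>?E J \<phi>\<bar> * \<bar>?E (I - J) \<phi>\<bar>)"
        by (simp add: sum.distrib sum_distrib_left sum.swap[of _ \<J>])
      also have "\<dots> \<le> C1 * (real (card V) * (2 / (1 - \<tau>)) ^ Suc q) + (\<Sum>J\<in>\<J>. C0\<^sup>2 * ?s ^ Suc q)"
      proof (intro add_mono mult_left_mono sum_mono block C1)
        show "(\<Sum>\<phi>\<in>PiE I (\<lambda>_. V). \<theta> ^ (Max (\<phi> ` I) - Min (\<phi> ` I)))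
            \<le> real (card V) * (2 / (1 - \<tau>)) ^ Suc q"
          using sum_geometric_diameter[OF \<tau>(1,2) V(1) I(1,2)] unfolding 3(1) \<tau>(3) .
      qed
      also have "\<dots> \<le> G * ?s ^ Suc q + 2 ^ Suc q * (C0\<^sup>2 * ?s ^ Suc q)"
      proof (intro add_mono)
        have "real (card V) = ?s ^ 2" by simp
        also have "\<dots> \<le> ?s ^ Suc q" using s 3(2) by (intro power_increasing) auto
        finally have "G * real (card V) \<le> G * ?s ^ Suc q" by (intro mult_left_mono G)
        then show "C1 * (real (card V) * (2 / (1 - \<tau>)) ^ Suc q) \<le> G * ?s ^ Suc q"
          by (simp only: G_def mult_ac)
        have "real (card \<J>) \<le> 2 ^ Suc q" using card\<J> by (metis of_nat_le_iff of_nat_numeral of_nat_power)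
        then show "(\<Sum>J\<in>\<J>. C0\<^sup>2 * ?s ^ Suc q) \<le> 2 ^ Suc q * (C0\<^sup>2 * ?s ^ Suc q)"
          unfolding sum_constant using s by (intro mult_right_mono) auto
      qed
      also have "\<dots> = (G + 2 ^ Suc q * C0\<^sup>2) * ?s ^ Suc q" by (simp only: distrib_right mult.assoc)
      also have "\<dots> \<le> C * ?s ^ Suc q" using C(3) s by (intro mult_right_mono) auto
      finally show ?thesis by (simp only: 3(1))
    qed
  qed
qed

lemma moment_bound:
  fixes M :: "'w::metric_space measure" and q :: nat
  assumes M: "prob_space M" and mp: "measure_preserving_map M T"
    and dec: "decorrelation_property M T \<eta> r" and r: "1 \<le> r" and K: "0 \<le> K" and q: "1 \<le> q"
  shows "\<exists>C\<ge>0. \<forall>g V. observable_family M \<eta> K g \<and> (\<forall>k. (\<integral>w. g k w \<partial>M) = 0) \<and> finite V \<longrightarrow>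
      (\<integral>w. (\<Sum>k\<in>V. g k ((T ^^ k) w)) ^ q \<partial>M) \<le> C * sqrt (real (card V)) ^ q"
proof -
  interpret prob_space M by fact
  obtain C where C: "0 \<le> C" and sum_bound:
    "\<forall>g I V. observable_family M \<eta> K g \<and> (\<forall>k. (\<integral>w. g k w \<partial>M) = 0) \<and>
      finite I \<and> I \<noteq> {} \<and> card I \<le> q \<and> finite V \<and> V \<noteq> {} \<longrightarrow>
      (\<Sum>\<phi>\<in>PiE I (\<lambda>_. V). \<bar>correlation M T g I \<phi>\<bar>) \<le> C * sqrt (real (card V)) ^ card I"
    using sum_correlation_bound[OF M mp dec r K, of q] by (elim exE conjE) (rule that)
  show ?thesis
  proof (intro exI[of _ C] conjI allI impI C, elim conjE)
    fix g :: "nat \<Rightarrow> 'w \<Rightarrow> real" and V :: "nat set"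
    assume g: "observable_family M \<eta> K g" "\<forall>k. (\<integral>w. g k w \<partial>M) = 0" and V: "finite V"
    let ?I = "{..<q}"
    show "(\<integral>w. (\<Sum>k\<in>V. g k ((T ^^ k) w)) ^ q \<partial>M) \<le> C * sqrt (real (card V)) ^ q"
    proof (cases "V = {}")
      case True
      then show ?thesis using q by (simp add: power_0_left)
    next
      case False
      have Tm: "T ^^ n \<in> measurable M M" for n
        using measure_preserving_funpow[OF mp] by (auto simp: measure_preserving_map_def)
      have gm: "g k \<in> borel_measurable M" and g1: "\<bar>g k w\<bar> \<le> 1" for k w
        using g(1) by (auto simp: observable_family_def)
      have expand: "(\<Sum>k\<in>V. g k ((T ^^ k) w)) ^ q =
          (\<Sum>\<phi>\<in>PiE ?I (\<lambda>_. V). \<Prod>i\<in>?I. g (\<phi> i) ((T ^^ \<phi> i) w))" for w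
        using prod_sum_PiE[of ?I "\<lambda>_. V" "\<lambda>_ k. g k ((T ^^ k) w)"] V by simp
      have "(\<integral>w. (\<Sum>k\<in>V. g k ((T ^^ k) w)) ^ q \<partial>M) = (\<Sum>\<phi>\<in>PiE ?I (\<lambda>_. V). correlation M T g ?I \<phi>)"
        unfolding expand correlation_def
      proof (rule Bochner_Integration.integral_sum)
        fix \<phi>
        show "integrable M (\<lambda>w. \<Prod>i\<in>?I. g (\<phi> i) ((T ^^ \<phi> i) w))"
          by (rule integrable_const_bound[where B = 1])
            (auto intro!: AE_I2 abs_prod_le_1 g1 borel_measurable_prod measurable_compose[OF Tm gm])
      qed
      also have "\<dots> \<le> (\<Sum>\<phi>\<in>PiE ?I (\<lambda>_. V). \<bar>correlation M T g ?I \<phi>\<bar>)" by (rule sum_mono) simp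
      also have "\<dots> \<le> C * sqrt (real (card V)) ^ card ?I"
        using q V False g by (intro sum_bound[rule_format]) (auto simp: lessThan_empty_iff)
      finally show ?thesis by simp
    qed
  qed
qed

section \<open>Maximal partial sums\<close>

text \<open>A factor close to \<open>1\<close> on one summand can be bought by a large factor on the other; the value \<open>2\<close> leaves room in the
recursion of \<open>maximal_partial_sums\<close>.\<close>

lemma power_add_le_weighted:
  fixes q :: nat
  assumes "1 \<le> q"
  shows "\<exists>c\<ge>0::real. \<forall>x\<ge>0. \<forall>y\<ge>0. (x + y) ^ q \<le> 2 * y ^ q + c * x ^ q"
proof -
  define \<tau> where "\<tau> = root q 2 - 1"
  have "0 < q" using assms by simp
  then have root: "root q 2 ^ q = 2" "1 < root q 2" using real_root_less_iff[of q 1 2] by auto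
  have \<tau>: "0 < \<tau>" "(1 + \<tau>) ^ q = 2" using root by (auto simp: \<tau>_def)
  define c where "c = (1 + 1 / \<tau>) ^ q"
  have c: "0 \<le> c" using \<tau> by (simp add: c_def)
  have "(x + y) ^ q \<le> 2 * y ^ q + c * x ^ q" if "0 \<le> x" "0 \<le> y" for x y
  proof (cases "x \<le> \<tau> * y")
    case True
    then have "(x + y) ^ q \<le> ((1 + \<tau>) * y) ^ q"
      using that by (intro power_mono) (auto simp: algebra_simps)
    also have "\<dots> = 2 * y ^ q" by (simp add: power_mult_distrib \<tau>(2))
    finally show ?thesis using mult_nonneg_nonneg[OF c zero_le_power[OF that(1), of q]] by linarith
  next
    case False
    then have "y \<le> x / \<tau>" using \<tau> by (simp add: field_simps)
    then have "(x + y) ^ q \<le> ((1 + 1 / \<tau>) * x) ^ q"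
      using that by (intro power_mono) (auto simp: algebra_simps)
    also have "\<dots> = c * x ^ q" by (simp add: power_mult_distrib c_def)
    finally show ?thesis using zero_le_power[OF that(2), of q] by linarith
  qed
  with c show ?thesis by blast
qed

text \<open>Doubling the time window: a partial sum that ends in the second half is the full first half plus a partial sum of
the second half. Hence a dominating function for the window of length \<open>2 ^ Suc K\<close> is obtained from those of the two
halves, with weights \<open>1\<close> and \<open>2\<close>, and a multiple of the power \<open>2 * p\<close> of the full first half. The expectations
grow by the factor \<open>1 + 2 + 1 = 4\<close>, which does not exceed \<open>2 ^ p\<close> because \<open>p \<ge> 2\<close>.\<close>

lemma maximal_partial_sums:
  fixes Y :: "nat \<Rightarrow> 'w \<Rightarrow> real" and c C :: real
  assumes M: "prob_space M"
    and meas: "\<And>k. Y k \<in> borel_measurable M" and bound: "\<And>k w. \<bar>Y k w\<bar> \<le> 1"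
    and p: "2 \<le> p" and c: "0 \<le> c"
    and weighted: "\<And>x y :: real. \<lbrakk>0 \<le> x; 0 \<le> y\<rbrakk> \<Longrightarrow> (x + y) ^ (2 * p) \<le> 2 * y ^ (2 * p) + c * x ^ (2 * p)"
    and moment: "\<And>a n. (\<integral>w. \<bar>\<Sum>k\<in>{a..<a + n}. Y k w\<bar> ^ (2 * p) \<partial>M) \<le> C * real n ^ p"
  shows "\<exists>B. integrable M B \<and> (\<forall>w. \<forall>n\<le>2 ^ K. \<bar>\<Sum>k\<in>{a..<a + n}. Y k w\<bar> ^ (2 * p) \<le> B w) \<and>
    (\<integral>w. B w \<partial>M) \<le> (c + 1) * C * (2 ^ K) ^ p"
proof (induction K arbitrary: a)
  interpret prob_space M by fact
  let ?S = "\<lambda>a n w. \<bar>\<Sum>k\<in>{a..<a + n}. Y k w\<bar>"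
  have int: "integrable M (\<lambda>w. ?S a n w ^ (2 * p))" for a n
  proof (rule integrable_const_bound[where B = "real n ^ (2 * p)"])
    have "?S a n w \<le> real n" for w
      using sum_norm_le[of "{a..<a + n}" "\<lambda>k. Y k w" "\<lambda>_. 1"] bound by simp
    then show "AE w in M. norm (?S a n w ^ (2 * p)) \<le> real n ^ (2 * p)"
      unfolding real_norm_def power_abs abs_idempotent by (intro AE_I2 power_mono) auto
  qed (use meas in measurable)
  have C: "0 \<le> C"
  proof -
    have "0 \<le> (\<integral>w. ?S 0 1 w ^ (2 * p) \<partial>M)" by (rule integral_nonneg_AE) simp
    also have "\<dots> \<le> C" using moment[of 0 1] by simp
    finally show ?thesis .
  qed
  {
    case 0
    have "?S a n w ^ (2 * p) \<le> ?S a 1 w ^ (2 * p)" if "n \<le> 2 ^ 0" for w n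
      using that p by (cases n) auto
    moreover have "(\<integral>w. ?S a 1 w ^ (2 * p) \<partial>M) \<le> (c + 1) * C * (2 ^ 0) ^ p"
      using moment[of a 1] mult_nonneg_nonneg[OF c C] by (simp add: algebra_simps)
    ultimately show ?case using int by blast
  next
    case (Suc K)
    from Suc.IH[of a] obtain B1 where B1: "integrable M B1" "\<And>w n. n \<le> 2 ^ K \<Longrightarrow> ?S a n w ^ (2 * p) \<le> B1 w"
      "(\<integral>w. B1 w \<partial>M) \<le> (c + 1) * C * (2 ^ K) ^ p" by blast
    from Suc.IH[of "a + 2 ^ K"] obtain B2 where B2: "integrable M B2"
      "\<And>w n. n \<le> 2 ^ K \<Longrightarrow> ?S (a + 2 ^ K) n w ^ (2 * p) \<le> B2 w"
      "(\<integral>w. B2 w \<partial>M) \<le> (c + 1) * C * (2 ^ K) ^ p" by blast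
    define B where "B = (\<lambda>w. B1 w + 2 * B2 w + c * ?S a (2 ^ K) w ^ (2 * p))"
    have nonneg: "0 \<le> B1 w" "0 \<le> B2 w" for w
      by (rule order_trans[OF _ B1(2)[of 0 w]], simp, simp)
        (rule order_trans[OF _ B2(2)[of 0 w]], simp, simp)
    have dom: "?S a n w ^ (2 * p) \<le> B w" if n: "n \<le> 2 ^ Suc K" for n w
    proof (cases "n \<le> 2 ^ K")
      case True
      have "0 \<le> c * ?S a (2 ^ K) w ^ (2 * p)" using c by simp
      with B1(2)[OF True, of w] nonneg[of w] show ?thesis unfolding B_def by linarith
    next
      case False
      define m where "m = n - 2 ^ K"
      have m: "n = 2 ^ K + m" "m \<le> 2 ^ K" using False n by (auto simp: m_def)
      have "(\<Sum>k\<in>{a..<a + n}. Y k w) =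
          (\<Sum>k\<in>{a..<a + 2 ^ K}. Y k w) + (\<Sum>k\<in>{a + 2 ^ K..<a + 2 ^ K + m}. Y k w)"
        unfolding m(1) by (subst sum.atLeastLessThan_concat) (auto simp: add.assoc)
      then have "?S a n w \<le> ?S a (2 ^ K) w + ?S (a + 2 ^ K) m w" by linarith
      then have "?S a n w ^ (2 * p) \<le> (?S a (2 ^ K) w + ?S (a + 2 ^ K) m w) ^ (2 * p)"
        by (intro power_mono) auto
      also have "\<dots> \<le> 2 * ?S (a + 2 ^ K) m w ^ (2 * p) + c * ?S a (2 ^ K) w ^ (2 * p)"
        by (intro weighted) auto
      finally show ?thesis using B2(2)[OF m(2), of w] nonneg[of w] unfolding B_def by linarith
    qed
    have "(\<integral>w. B w \<partial>M) = (\<integral>w. B1 w \<partial>M) + 2 * (\<integral>w. B2 w \<partial>M) + c * (\<integral>w. ?S a (2 ^ K) w ^ (2 * p) \<partial>M)"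
      unfolding B_def using B1(1) B2(1) int[of a "2 ^ K"] by simp
    also have "\<dots> \<le> (c + 1) * C * (2 ^ K) ^ p + 2 * ((c + 1) * C * (2 ^ K) ^ p) + c * (C * (2 ^ K) ^ p)"
    proof -
      have "c * (\<integral>w. ?S a (2 ^ K) w ^ (2 * p) \<partial>M) \<le> c * (C * (2 ^ K) ^ p)"
        using moment[of a "2 ^ K"] c by (intro mult_left_mono) auto
      with B1(3) B2(3) show ?thesis by linarith
    qed
    also have "\<dots> \<le> 4 * ((c + 1) * C * (2 ^ K) ^ p)"
      using C by (simp add: algebra_simps)
    also have "\<dots> \<le> 2 ^ p * ((c + 1) * C * (2 ^ K) ^ p)"
    proof (rule mult_right_mono)
      show "4 \<le> (2::real) ^ p" using power_increasing[OF p, of "2::real"] by simp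
    qed (use c C in simp)
    also have "\<dots> = (c + 1) * C * (2 ^ Suc K) ^ p" by (simp add: power_mult_distrib)
    finally have "(\<integral>w. B w \<partial>M) \<le> (c + 1) * C * (2 ^ Suc K) ^ p" .
    moreover have "integrable M B" unfolding B_def using B1(1) B2(1) int[of a "2 ^ K"] by simp
    ultimately show ?case using dom by blast
  }
qed

section \<open>Euler steps and the deterministic averaging error\<close>

lemma discrete_gronwall:
  fixes u :: "nat \<Rightarrow> real"
  assumes h: "0 \<le> h" and u: "\<And>n. n \<le> N \<Longrightarrow> u n \<le> Q + h * (\<Sum>k<n. u k)" and "n \<le> N"
  shows "u n \<le> Q * (1 + h) ^ n"
  using \<open>n \<le> N\<close>
proof (induction n rule: less_induct)
  case (less n)
  have "u n \<le> Q + h * (\<Sum>k<n. u k)" by (rule u[OF less.prems])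
  also have "\<dots> \<le> Q + h * (\<Sum>k<n. Q * (1 + h) ^ k)"
    using less h by (intro add_left_mono mult_left_mono sum_mono) auto
  also have "\<dots> = Q + Q * (h * (\<Sum>k<n. (1 + h) ^ k))" by (simp add: sum_distrib_left mult_ac)
  also have "h * (\<Sum>k<n. (1 + h) ^ k) = (1 + h) ^ n - 1"
    using power_diff_1_eq[of "1 + h" n] by simp
  finally show ?case by (simp add: algebra_simps)
qed

lemma euler_step:
  fixes y :: "real \<Rightarrow> 'a::real_normed_vector"
  assumes ab: "a \<le> b" and cont: "continuous_on {a..b} y"
    and deriv: "\<And>t. \<lbrakk>a < t; t < b\<rbrakk> \<Longrightarrow> (y has_vector_derivative f (y t)) (at t)"
    and B: "\<And>u. norm (f u) \<le> B" and L: "L-lipschitz_on UNIV f"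
  shows "norm (y b - y a) \<le> B * (b - a)"
    and "norm (y b - y a - (b - a) *\<^sub>R f (y a)) \<le> L * B * (b - a)\<^sup>2"
proof -
  have speed: "norm (y t - y a) \<le> B * (t - a)" if t: "a \<le> t" "t \<le> b" for t
  proof (cases "a = t")
    case False
    have "norm (y t - y a) \<le> B * t - B * a"
    proof (rule differentiable_bound_general[where \<phi> = "\<lambda>s. B * s" and \<phi>' = "\<lambda>_. B" and f' = "\<lambda>s. f (y s)"])
      show "continuous_on {a..t} y" using cont t by (auto intro: continuous_on_subset)
      show "((\<lambda>s. B * s) has_vector_derivative B) (at s)" for s
        by (auto intro!: derivative_eq_intros simp: has_real_derivative_iff_has_vector_derivative[symmetric])
    qed (use False t deriv B in \<open>auto intro!: continuous_intros\<close>)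
    then show ?thesis by (simp add: algebra_simps)
  qed simp
  then show "norm (y b - y a) \<le> B * (b - a)" using ab by simp
  have L0: "0 \<le> L" by (rule lipschitz_on_nonneg[OF L])
  have B0: "0 \<le> B" using B[of 0] norm_ge_zero order_trans by blast
  show "norm (y b - y a - (b - a) *\<^sub>R f (y a)) \<le> L * B * (b - a)\<^sup>2"
  proof (cases "a = b")
    case False
    let ?z = "\<lambda>t. y t - t *\<^sub>R f (y a)"
    have "norm (?z b - ?z a) \<le> (L * B * (b - a)) * b - (L * B * (b - a)) * a"
    proof (rule differentiable_bound_general[where \<phi> = "\<lambda>s. (L * B * (b - a)) * s"
          and \<phi>' = "\<lambda>_. L * B * (b - a)" and f' = "\<lambda>s. f (y s) - f (y a)"])
      show "((\<lambda>s. (L * B * (b - a)) * s) has_vector_derivative L * B * (b - a)) (at s)" for s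
        by (auto intro!: derivative_eq_intros simp: has_real_derivative_iff_has_vector_derivative[symmetric])
      show "(?z has_vector_derivative f (y s) - f (y a)) (at s)" if "a < s" "s < b" for s
        using deriv[OF that] by (auto intro!: derivative_eq_intros)
      show "norm (f (y s) - f (y a)) \<le> L * B * (b - a)" if s: "a < s" "s < b" for s
      proof -
        have "norm (f (y s) - f (y a)) \<le> L * norm (y s - y a)"
          using lipschitz_onD[OF L, of "y s" "y a"] by (simp add: dist_norm)
        also have "\<dots> \<le> L * (B * (b - a))"
          using speed[of s] s B0 L0 mult_left_mono[of "s - a" "b - a" B] by (intro mult_left_mono) auto
        finally show ?thesis by simp
      qed
    qed (use False ab cont in \<open>auto intro!: continuous_intros\<close>)
    also have "?z b - ?z a = y b - y a - (b - a) *\<^sub>R f (y a)" by (simp add: algebra_simps)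
    finally show ?thesis by (simp add: algebra_simps power2_eq_square)
  qed simp
qed

text \<open>Explicit Euler iterates depend measurably on parameters by construction; their convergence transfers
this to the solution.\<close>

lemma euler_iterates_tendsto:
  fixes y :: "real \<Rightarrow> 'a::real_normed_vector"
  assumes ab: "a \<le> b" and cont: "continuous_on {a..b} y"
    and deriv: "\<And>t. \<lbrakk>a < t; t < b\<rbrakk> \<Longrightarrow> (y has_vector_derivative f (y t)) (at t)"
    and B: "\<And>u. norm (f u) \<le> B" and L: "L-lipschitz_on UNIV f"
  shows "(\<lambda>m. ((\<lambda>u. u + ((b - a) / real m) *\<^sub>R f u) ^^ m) (y a)) \<longlonglongrightarrow> y b"
proof -
  have L0: "0 \<le> L" by (rule lipschitz_on_nonneg[OF L])
  have B0: "0 \<le> B" using B[of 0] norm_ge_zero order_trans by blast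
  define Y where "Y m j = ((\<lambda>u. u + ((b - a) / real m) *\<^sub>R f u) ^^ j) (y a)" for m j
  have err: "norm (Y m m - y b) \<le> L * B * (b - a)\<^sup>2 * exp (L * (b - a)) * (1 / real m)"
    if m: "0 < m" for m
  proof -
    define h where "h = (b - a) / real m"
    have h: "0 \<le> h" "real m * h = b - a" using ab m by (auto simp: h_def)
    define e where "e j = y (a + real j * h) - Y m j" for j
    have step: "norm (e (Suc j)) \<le> norm (e j) + h * L * norm (e j) + L * B * h\<^sup>2" if j: "j < m" for j
    proof -
      let ?s = "a + real j * h" and ?t = "a + real (Suc j) * h"
      have "real (Suc j) * h \<le> real m * h" using j h(1) by (intro mult_right_mono) auto
      then have t: "a \<le> ?s" "?s \<le> ?t" "?t \<le> b" using h by (auto simp: algebra_simps)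
      have "norm (y ?t - y ?s - (?t - ?s) *\<^sub>R f (y ?s)) \<le> L * B * (?t - ?s)\<^sup>2"
        using t by (intro euler_step(2) B L deriv continuous_on_subset[OF cont]) auto
      then have r: "norm (y ?t - y ?s - h *\<^sub>R f (y ?s)) \<le> L * B * h\<^sup>2" by (simp add: algebra_simps)
      have "norm (h *\<^sub>R (f (y ?s) - f (Y m j))) \<le> h * (L * norm (e j))"
        using lipschitz_onD[OF L, of "y ?s" "Y m j"] h(1)
        by (simp add: e_def dist_norm mult_left_mono)
      moreover have "e (Suc j) = e j + h *\<^sub>R (f (y ?s) - f (Y m j)) + (y ?t - y ?s - h *\<^sub>R f (y ?s))"
        by (simp add: e_def Y_def h_def[symmetric] algebra_simps)
      ultimately show ?thesis
        using r norm_triangle_ineq[of "e j + h *\<^sub>R (f (y ?s) - f (Y m j))" "y ?t - y ?s - h *\<^sub>R f (y ?s)"]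
          norm_triangle_ineq[of "e j" "h *\<^sub>R (f (y ?s) - f (Y m j))"] by (simp add: mult.assoc)
    qed
    have acc: "norm (e n) \<le> real n * (L * B * h\<^sup>2) + h * L * (\<Sum>k<n. norm (e k))" if "n \<le> m" for n
      using that
    proof (induction n)
      case 0
      show ?case by (simp add: e_def Y_def)
    next
      case (Suc n)
      then show ?case using step[of n] by (simp add: algebra_simps)
    qed
    have "norm (e m) \<le> (real m * (L * B * h\<^sup>2)) * (1 + h * L) ^ m"
    proof (rule discrete_gronwall[where N = m])
      fix n assume n: "n \<le> m"
      have "real n * (L * B * h\<^sup>2) \<le> real m * (L * B * h\<^sup>2)"
        using n L0 B0 by (intro mult_right_mono) auto
      then show "norm (e n) \<le> real m * (L * B * h\<^sup>2) + h * L * (\<Sum>k<n. norm (e k))"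
        using acc[OF n] by linarith
    qed (use h L0 in auto)
    also have "\<dots> \<le> (real m * (L * B * h\<^sup>2)) * exp (L * (b - a))"
    proof (rule mult_left_mono)
      have "(1 + h * L) ^ m \<le> exp (h * L) ^ m" using h L0 by (intro power_mono exp_ge_add_one_self) auto
      also have "\<dots> = exp (L * (b - a))" unfolding h(2)[symmetric] by (simp add: exp_of_nat_mult[symmetric] mult_ac)
      finally show "(1 + h * L) ^ m \<le> exp (L * (b - a))" .
    qed (use L0 B0 in auto)
    also have "real m * (L * B * h\<^sup>2) = L * B * (b - a)\<^sup>2 * (1 / real m)"
      using m by (simp add: h_def power2_eq_square field_simps)
    also have "norm (e m) = norm (Y m m - y b)" using h(2) by (simp add: e_def norm_minus_commute)
    finally show ?thesis by (simp add: mult_ac)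
  qed
  have "(\<lambda>m. Y m m - y b) \<longlonglongrightarrow> 0"
  proof (rule Lim_null_comparison)
    show "\<forall>\<^sub>F m in sequentially. norm (Y m m - y b) \<le> L * B * (b - a)\<^sup>2 * exp (L * (b - a)) * (1 / real m)"
      using eventually_gt_at_top[of 0] by eventually_elim (rule err)
    show "(\<lambda>m. L * B * (b - a)\<^sup>2 * exp (L * (b - a)) * (1 / real m)) \<longlonglongrightarrow> 0"
      by (intro tendsto_mult_right_zero lim_1_over_n)
  qed
  then show ?thesis unfolding Y_def by (simp add: LIM_zero_iff)
qed

text \<open>Compare both solutions on the grid of mesh \<open>\<epsilon>\<close>. The increment of the difference over one cell splits into a
Lipschitz term in the current difference, the fluctuation \<open>f k - G\<close> evaluated along the averaged
solution, and two Euler errors of order \<open>\<epsilon>\<^sup>2\<close>. Since the fluctuation is taken at points that do not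
depend on the driving sequence \<open>f\<close>, it remains a sum along an orbit when \<open>f\<close> is random.\<close>

lemma averaging_error:
  fixes X W :: "real \<Rightarrow> 'a::real_normed_vector"
  assumes \<epsilon>: "0 < \<epsilon>" and start: "X 0 = W 0"
    and X: "continuous_on {0..} X"
      "\<And>k t. \<lbrakk>real k * \<epsilon> < t; t < real (Suc k) * \<epsilon>\<rbrakk> \<Longrightarrow> (X has_vector_derivative f k (X t)) (at t)"
    and W: "continuous_on {0..} W" "\<And>t. 0 < t \<Longrightarrow> (W has_vector_derivative G (W t)) (at t)"
    and f: "\<And>k u. norm (f k u) \<le> B" "\<And>k. L-lipschitz_on UNIV (f k)"
    and G: "\<And>u. norm (G u) \<le> B" "L-lipschitz_on UNIV G"
    and Q: "\<And>n. n \<le> N \<Longrightarrow> norm (\<Sum>k<n. f k (W (real k * \<epsilon>)) - G (W (real k * \<epsilon>))) \<le> Q"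
    and t: "0 \<le> t" "t < real N * \<epsilon>"
  shows "norm (X t - W t) \<le> (\<epsilon> * Q + real N * (2 * L * B * \<epsilon>\<^sup>2)) * (1 + \<epsilon> * L) ^ N + 2 * B * \<epsilon>"
proof -
  have L0: "0 \<le> L" by (rule lipschitz_on_nonneg[OF G(2)])
  have B0: "0 \<le> B" using G(1)[of 0] norm_ge_zero order_trans by blast
  have Q0: "0 \<le> Q" using Q[of 0] by simp
  define x w where "x k = X (real k * \<epsilon>)" and "w k = W (real k * \<epsilon>)" for k
  define d where "d k = f k (w k) - G (w k)" for k
  define r where "r k = (x (Suc k) - x k - \<epsilon> *\<^sub>R f k (x k)) - (w (Suc k) - w k - \<epsilon> *\<^sub>R G (w k))" for k
  have r: "norm (r k) \<le> 2 * L * B * \<epsilon>\<^sup>2" for k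
  proof -
    let ?s = "real k * \<epsilon>" and ?t = "real (Suc k) * \<epsilon>"
    have st: "0 \<le> ?s" "?s \<le> ?t" "?t - ?s = \<epsilon>" using \<epsilon> by (auto simp: algebra_simps)
    have "norm (X ?t - X ?s - (?t - ?s) *\<^sub>R f k (X ?s)) \<le> L * B * (?t - ?s)\<^sup>2"
      by (rule euler_step(2)[where f = "f k"])
        (use st(1,2) in \<open>auto intro: f X continuous_on_subset[OF X(1)]\<close>)
    moreover have "norm (W ?t - W ?s - (?t - ?s) *\<^sub>R G (W ?s)) \<le> L * B * (?t - ?s)\<^sup>2"
      by (rule euler_step(2)[where f = G])
        (use st(1,2) in \<open>auto intro: G W continuous_on_subset[OF W(1)]\<close>)
    ultimately show ?thesis
      unfolding r_def x_def w_def st(3)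
      using norm_triangle_ineq4[of "X ?t - X ?s - \<epsilon> *\<^sub>R f k (X ?s)" "W ?t - W ?s - \<epsilon> *\<^sub>R G (W ?s)"]
      by linarith
  qed
  define e where "e k = x k - w k" for k
  have e_sum: "e n = (\<Sum>k<n. \<epsilon> *\<^sub>R (f k (x k) - f k (w k))) + \<epsilon> *\<^sub>R (\<Sum>k<n. d k) + (\<Sum>k<n. r k)" for n
  proof (induction n)
    case 0
    show ?case by (simp add: e_def x_def w_def start)
  next
    case (Suc n)
    have "e (Suc n) = e n + (\<epsilon> *\<^sub>R (f n (x n) - f n (w n)) + \<epsilon> *\<^sub>R d n + r n)"
      by (simp add: e_def r_def d_def algebra_simps)
    then show ?case using Suc by (simp add: algebra_simps)
  qed
  have e_bound: "norm (e n) \<le> (\<epsilon> * Q + real N * (2 * L * B * \<epsilon>\<^sup>2)) + \<epsilon> * L * (\<Sum>k<n. norm (e k))"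
    if n: "n \<le> N" for n
  proof -
    have 1: "norm (\<Sum>k<n. \<epsilon> *\<^sub>R (f k (x k) - f k (w k))) \<le> (\<Sum>k<n. \<epsilon> * L * norm (e k))"
    proof (rule sum_norm_le)
      fix k
      show "norm (\<epsilon> *\<^sub>R (f k (x k) - f k (w k))) \<le> \<epsilon> * L * norm (e k)"
        using lipschitz_onD[OF f(2), of "x k" "w k" k] \<epsilon> by (simp add: e_def dist_norm mult.assoc)
    qed
    have 2: "norm (\<epsilon> *\<^sub>R (\<Sum>k<n. d k)) \<le> \<epsilon> * Q"
      using Q[OF n] \<epsilon> by (simp add: d_def w_def)
    have "norm (\<Sum>k<n. r k) \<le> (\<Sum>k<n. 2 * L * B * \<epsilon>\<^sup>2)" by (rule sum_norm_le) (rule r)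
    also have "\<dots> \<le> real N * (2 * L * B * \<epsilon>\<^sup>2)"
      using n L0 B0 by (simp add: mult_right_mono)
    finally have 3: "norm (\<Sum>k<n. r k) \<le> real N * (2 * L * B * \<epsilon>\<^sup>2)" .
    show ?thesis
      unfolding e_sum[of n] sum_distrib_left
      using 1 2 3 norm_triangle_ineq[of "(\<Sum>k<n. \<epsilon> *\<^sub>R (f k (x k) - f k (w k))) + \<epsilon> *\<^sub>R (\<Sum>k<n. d k)" "\<Sum>k<n. r k"]
        norm_triangle_ineq[of "\<Sum>k<n. \<epsilon> *\<^sub>R (f k (x k) - f k (w k))" "\<epsilon> *\<^sub>R (\<Sum>k<n. d k)"]
      by linarith
  qed
  define n where "n = nat \<lfloor>t / \<epsilon>\<rfloor>"
  have fl: "real n = of_int \<lfloor>t / \<epsilon>\<rfloor>" using t \<epsilon> by (simp add: n_def)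
  have n: "real n * \<epsilon> \<le> t" "t \<le> real (Suc n) * \<epsilon>"
  proof -
    have "real n \<le> t / \<epsilon>" "t / \<epsilon> \<le> real (Suc n)" using fl by linarith+
    then show "real n * \<epsilon> \<le> t" "t \<le> real (Suc n) * \<epsilon>" using \<epsilon> by (simp_all add: field_simps)
  qed
  have nN: "n \<le> N"
  proof -
    have "real n * \<epsilon> < real N * \<epsilon>" using n(1) t by linarith
    then show ?thesis using \<epsilon> by simp
  qed
  have "norm (e n) \<le> (\<epsilon> * Q + real N * (2 * L * B * \<epsilon>\<^sup>2)) * (1 + \<epsilon> * L) ^ n"
    using discrete_gronwall[where N = N and u = "\<lambda>k. norm (e k)", OF _ e_bound nN] \<epsilon> L0 by simp
  also have "\<dots> \<le> (\<epsilon> * Q + real N * (2 * L * B * \<epsilon>\<^sup>2)) * (1 + \<epsilon> * L) ^ N"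
    using \<epsilon> L0 B0 Q0 nN by (intro mult_left_mono power_increasing) auto
  finally have en: "norm (e n) \<le> (\<epsilon> * Q + real N * (2 * L * B * \<epsilon>\<^sup>2)) * (1 + \<epsilon> * L) ^ N" .
  let ?s = "real n * \<epsilon>"
  have "0 \<le> ?s" using \<epsilon> by simp
  have step: "B * (t - ?s) \<le> B * \<epsilon>" using n(2) B0 by (intro mult_left_mono) (auto simp: algebra_simps)
  have "norm (X t - X ?s) \<le> B * (t - ?s)"
    by (rule euler_step(1)[where f = "f n"])
      (use n \<open>0 \<le> ?s\<close> in \<open>auto intro: f X continuous_on_subset[OF X(1)]\<close>)
  moreover have "norm (W t - W ?s) \<le> B * (t - ?s)"
    by (rule euler_step(1)[where f = G])
      (use n \<open>0 \<le> ?s\<close> in \<open>auto intro: G W continuous_on_subset[OF W(1)]\<close>)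
  moreover have "norm (X t - W t) \<le> norm (e n) + norm ((X t - X ?s) - (W t - W ?s))"
  proof -
    have "X t - W t = e n + ((X t - X ?s) - (W t - W ?s))" by (simp add: e_def x_def w_def)
    then show ?thesis by (simp only: norm_triangle_ineq)
  qed
  ultimately show ?thesis
    using en step norm_triangle_ineq4[of "X t - X ?s" "W t - W ?s"] by linarith
qed

section \<open>Measurability and norms\<close>

lemma borel_measurable_SUP_interval:
  fixes \<phi> :: "real \<Rightarrow> 'w \<Rightarrow> real"
  assumes meas: "\<And>t. t \<in> {a..b} \<Longrightarrow> \<phi> t \<in> borel_measurable M"
    and cont: "\<And>w. continuous_on {a..b} (\<lambda>t. \<phi> t w)" and ab: "a \<le> b"
  shows "(\<lambda>w. SUP t\<in>{a..b}. \<phi> t w) \<in> borel_measurable M"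
proof -
  obtain D where D: "countable D" "D \<subseteq> {a..b}" "{a..b} \<subseteq> closure D"
    using separable[of "{a..b}"] by blast
  have ne: "D \<noteq> {}" using D(3) ab by auto
  have clD: "closure D = {a..b}" using D by (simp add: closure_minimal subset_antisym)
  have bdd: "bdd_above ((\<lambda>t. \<phi> t w) ` {a..b})" for w
    using compact_continuous_image[OF cont[of w] compact_Icc]
    by (intro bounded_imp_bdd_above compact_imp_bounded)
  have bddD: "bdd_above ((\<lambda>t. \<phi> t w) ` D)" for w
    by (rule bdd_above_mono[OF bdd[of w]]) (use D in blast)
  have "(SUP t\<in>{a..b}. \<phi> t w) = (SUP t\<in>D. \<phi> t w)" for w
  proof (rule antisym)
    show "(SUP t\<in>{a..b}. \<phi> t w) \<le> (SUP t\<in>D. \<phi> t w)"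
    proof (rule cSUP_least)
      fix t assume "t \<in> {a..b}"
      then show "\<phi> t w \<le> (SUP t\<in>D. \<phi> t w)"
        by (rule continuous_le_on_closure[where S = D and f = "\<lambda>t. \<phi> t w", unfolded clD, OF cont])
          (rule cSUP_upper[OF _ bddD])
    qed (use ab in auto)
    show "(SUP t\<in>D. \<phi> t w) \<le> (SUP t\<in>{a..b}. \<phi> t w)"
      by (rule cSUP_subset_mono[OF ne bdd D(2)]) simp
  qed
  then show ?thesis
    using D(1,2) bddD meas by (auto intro!: borel_measurable_cSUP)
qed

lemma perturbed_solution_deriv:
  assumes sol: "perturbed_solution F T \<epsilon> x w X" and \<epsilon>: "0 < \<epsilon>"
    and t: "real k * \<epsilon> < t" "t < real (Suc k) * \<epsilon>"
  shows "(X has_vector_derivative F (X t, (T ^^ k) w)) (at t)"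
proof -
  have q: "real k < t / \<epsilon>" "t / \<epsilon> < real k + 1" using t \<epsilon> by (simp_all add: field_simps)
  then have "\<lfloor>t / \<epsilon>\<rfloor> = int k" by (intro floor_unique) auto
  moreover have "t \<notin> {\<epsilon> * of_int z |z. True}"
  proof
    assume "t \<in> {\<epsilon> * of_int z |z. True}"
    then obtain z :: int where "t / \<epsilon> = of_int z" using \<epsilon> by auto
    with q have "int k < z" "z < int k + 1" by linarith+
    then show False by simp
  qed
  moreover have "0 \<le> t" using t(1) mult_nonneg_nonneg[of "real k" \<epsilon>] \<epsilon> by linarith
  ultimately show ?thesis using sol by (auto simp: perturbed_solution_def)
qed

text \<open>Cell by cell: within a cell the equation is autonomous and the solution is the limit of Euler iterates started
at the value at the left end.\<close>

lemma perturbed_solution_measurable: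
  fixes F :: "(real^'d) \<times> 'w \<Rightarrow> real^'d"
  assumes F: "F \<in> borel_measurable (borel \<Otimes>\<^sub>M M)" and T: "T \<in> measurable M M"
    and B: "\<And>z. norm (F z) \<le> B" and L: "\<And>w. L-lipschitz_on UNIV (\<lambda>x. F (x, w))"
    and sol: "\<And>w. perturbed_solution F T \<epsilon> x w (X w)" and \<epsilon>: "0 < \<epsilon>" and t: "0 \<le> t"
  shows "(\<lambda>w. X w t) \<in> borel_measurable M"
proof -
  have Tk: "T ^^ k \<in> measurable M M" for k
  proof (induction k)
    case (Suc k)
    then show ?case using measurable_comp[OF Suc T] by (simp add: comp_def)
  qed simp
  have step: "(\<lambda>w. X w (real k * \<epsilon> + s)) \<in> borel_measurable M"
    if start: "(\<lambda>w. X w (real k * \<epsilon>)) \<in> borel_measurable M" and s: "0 \<le> s" "s \<le> \<epsilon>" for k s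
  proof -
    let ?it = "\<lambda>m w u. u + (s / real m) *\<^sub>R F (u, (T ^^ k) w)"
    have it: "(\<lambda>w. (?it m w ^^ j) (X w (real k * \<epsilon>))) \<in> borel_measurable M" for m j
    proof (induction j)
      case 0
      show ?case using start by simp
    next
      case (Suc j)
      have "(\<lambda>w. ((?it m w ^^ j) (X w (real k * \<epsilon>)), (T ^^ k) w)) \<in> measurable M (borel \<Otimes>\<^sub>M M)"
        by (intro measurable_Pair Suc Tk)
      from measurable_compose[OF this F] Suc show ?case by simp
    qed
    have lim: "(\<lambda>m. (?it m w ^^ m) (X w (real k * \<epsilon>))) \<longlonglongrightarrow> X w (real k * \<epsilon> + s)" for w
    proof -
      have "(\<lambda>m. ((\<lambda>u. u + ((real k * \<epsilon> + s - real k * \<epsilon>) / real m) *\<^sub>R F (u, (T ^^ k) w)) ^^ m)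
          (X w (real k * \<epsilon>))) \<longlonglongrightarrow> X w (real k * \<epsilon> + s)"
      proof (rule euler_iterates_tendsto[OF _ _ _ B L])
        have "0 \<le> real k * \<epsilon>" using \<epsilon> by simp
        then show "continuous_on {real k * \<epsilon>..real k * \<epsilon> + s} (X w)"
          using sol[of w] by (auto simp: perturbed_solution_def intro: continuous_on_subset)
        fix t assume t: "real k * \<epsilon> < t" "t < real k * \<epsilon> + s"
        then show "(X w has_vector_derivative F (X w t, (T ^^ k) w)) (at t)"
          using s by (intro perturbed_solution_deriv[OF sol \<epsilon>]) (auto simp: algebra_simps)
      qed (use s in simp)
      then show ?thesis by simp
    qed
    show ?thesis by (rule borel_measurable_LIMSEQ_metric[OF it lim])
  qed
  have grid: "(\<lambda>w. X w (real k * \<epsilon>)) \<in> borel_measurable M" for k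
  proof (induction k)
    case 0
    then show ?case using sol by (simp add: perturbed_solution_def)
  next
    case (Suc k)
    from step[OF Suc, of \<epsilon>] \<epsilon> show ?case by (simp add: algebra_simps)
  qed
  define n where "n = nat \<lfloor>t / \<epsilon>\<rfloor>"
  have "real n = of_int \<lfloor>t / \<epsilon>\<rfloor>" using t \<epsilon> by (simp add: n_def)
  then have "real n \<le> t / \<epsilon>" "t / \<epsilon> \<le> real n + 1" by linarith+
  then have "0 \<le> t - real n * \<epsilon>" "t - real n * \<epsilon> \<le> \<epsilon>" using \<epsilon> by (simp_all add: field_simps)
  from step[OF grid[of n] this] show ?thesis by simp
qed

text \<open>An integer moment controls smaller real exponents through \<open>z powr (2 * p) \<le> 1 + z ^ (2 * P)\<close>.\<close>

lemma Lq_norm_le_of_moment: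
  fixes f h :: "'w \<Rightarrow> real" and p :: real and P :: nat
  assumes M: "prob_space M" and f: "f \<in> borel_measurable M" "\<And>w. 0 \<le> f w" and s: "0 < s"
    and h: "integrable M h" "\<And>w. (f w / s) ^ (2 * P) \<le> h w" "(\<integral>w. h w \<partial>M) \<le> D"
    and p: "1 \<le> p" "p \<le> real P"
  shows "Lq_norm M (2 * p) f \<le> ennreal ((1 + D) * s)"
proof -
  interpret prob_space M by fact
  have h0: "0 \<le> h w" for w
    by (rule order_trans[OF zero_le_power h(2)]) (use f(2) s in simp)
  have D: "0 \<le> D" using h(3) h0 by (intro order_trans[OF integral_nonneg_AE h(3)]) auto
  have pt: "\<bar>f w\<bar> powr (2 * p) \<le> s powr (2 * p) * (1 + h w)" for w
  proof -
    define z where "z = f w / s"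
    have z: "0 \<le> z" "\<bar>f w\<bar> = s * z" using f(2)[of w] s by (auto simp: z_def)
    have "z powr (2 * p) \<le> 1 + z ^ (2 * P)"
    proof (cases "z \<le> 1")
      case True
      have "z powr (2 * p) \<le> 1 powr (2 * p)" using z True p by (intro powr_mono2) auto
      moreover have "0 \<le> z ^ (2 * P)" by (rule zero_le_power[OF z(1)])
      ultimately show ?thesis unfolding powr_one_eq_one by linarith
    next
      case False
      have "z powr (2 * p) \<le> z powr real (2 * P)" by (rule powr_mono) (use False p in auto)
      also have "\<dots> = z ^ (2 * P)" by (rule powr_realpow) (use False in simp)
      finally show ?thesis by linarith
    qed
    then have "z powr (2 * p) \<le> 1 + h w" using h(2)[of w] by (simp add: z_def)
    then show ?thesis unfolding z(2) using s z by (simp add: powr_mult mult_left_mono)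
  qed
  have int: "integrable M (\<lambda>w. s powr (2 * p) * (1 + h w))" using h(1) by simp
  have intf: "integrable M (\<lambda>w. \<bar>f w\<bar> powr (2 * p))"
  proof (rule Bochner_Integration.integrable_bound[OF int])
    show "(\<lambda>w. \<bar>f w\<bar> powr (2 * p)) \<in> borel_measurable M" using f(1) by measurable
    show "AE w in M. norm (\<bar>f w\<bar> powr (2 * p)) \<le> norm (s powr (2 * p) * (1 + h w))"
    proof (rule AE_I2)
      fix w
      show "norm (\<bar>f w\<bar> powr (2 * p)) \<le> norm (s powr (2 * p) * (1 + h w))"
        by (simp only: real_norm_def abs_of_nonneg[OF powr_ge_zero]) (rule order_trans[OF pt abs_ge_self])
    qed
  qed
  have "(\<integral>w. \<bar>f w\<bar> powr (2 * p) \<partial>M) \<le> (\<integral>w. s powr (2 * p) * (1 + h w) \<partial>M)"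
    using intf int by (rule integral_mono) (rule pt)
  also have "\<dots> = s powr (2 * p) * (1 + (\<integral>w. h w \<partial>M))" using h(1) by (simp add: prob_space)
  also have "\<dots> \<le> s powr (2 * p) * (1 + D)" using h(3) by (intro mult_left_mono) auto
  finally have "(\<integral>w. \<bar>f w\<bar> powr (2 * p) \<partial>M) powr (1 / (2 * p)) \<le> (s powr (2 * p) * (1 + D)) powr (1 / (2 * p))"
    by (intro powr_mono2 integral_nonneg_AE AE_I2) (use p in simp_all)
  also have "\<dots> = s * (1 + D) powr (1 / (2 * p))" using s D p by (simp add: powr_mult powr_powr)
  also have "\<dots> \<le> s * (1 + D) powr 1"
    using s D p by (intro mult_left_mono powr_mono) (auto simp: field_simps)
  finally show ?thesis
    using f(1) intf D by (simp add: Lq_norm_def ennreal_leI mult.commute)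
qed

lemma power_sum_le_sum_power:
  fixes a :: "'i \<Rightarrow> real"
  assumes "finite S" "\<And>i. i \<in> S \<Longrightarrow> 0 \<le> a i" "0 < q"
  shows "(\<Sum>i\<in>S. a i) ^ q \<le> real (card S) ^ q * (\<Sum>i\<in>S. a i ^ q)"
proof (cases "S = {}")
  case False
  have fin: "finite (a ` S)" using assms(1) by simp
  obtain i where i: "i \<in> S" "a i = Max (a ` S)"
    using Max_in[OF fin] False by (metis imageE image_is_empty)
  have "(\<Sum>i\<in>S. a i) \<le> (\<Sum>j\<in>S. a i)" using i(2) fin by (intro sum_mono) simp
  then have "(\<Sum>i\<in>S. a i) ^ q \<le> (real (card S) * a i) ^ q"
    using assms by (intro power_mono) (auto intro: sum_nonneg)
  also have "\<dots> = real (card S) ^ q * a i ^ q" by (rule power_mult_distrib)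
  also have "\<dots> \<le> real (card S) ^ q * (\<Sum>i\<in>S. a i ^ q)"
    using assms i(1) by (intro mult_left_mono member_le_sum) auto
  finally show ?thesis .
qed (use assms(3) in \<open>simp add: power_0_left\<close>)

text \<open>The constant \<open>A\<close> depends on the observables only through the Hoelder constant \<open>K\<close>. This gives uniformity in the
starting point and in \<open>\<epsilon>\<close>, which both enter through the family \<open>g\<close>.\<close>

lemma maximal_fluctuation:
  fixes M :: "'w::metric_space measure" and p :: nat
  assumes M: "prob_space M" and mp: "measure_preserving_map M T"
    and dec: "decorrelation_property M T \<eta> r" and r: "1 \<le> r" and K: "0 \<le> K" and p: "2 \<le> p"
  shows "\<exists>A\<ge>0. \<forall>g n. observable_family M \<eta> K g \<and> (\<forall>k. (\<integral>w. g k w \<partial>M) = 0) \<longrightarrow>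
    (\<exists>B. integrable M B \<and> (\<forall>w. \<forall>m\<le>2 ^ n. \<bar>\<Sum>k<m. g k ((T ^^ k) w)\<bar> ^ (2 * p) \<le> B w) \<and>
      (\<integral>w. B w \<partial>M) \<le> A * (2 ^ n) ^ p)"
proof -
  have "1 \<le> 2 * p" using p by simp
  obtain C where C: "0 \<le> C" and moment:
    "\<forall>g V. observable_family M \<eta> K g \<and> (\<forall>k. (\<integral>w. g k w \<partial>M) = 0) \<and> finite V \<longrightarrow>
      (\<integral>w. (\<Sum>k\<in>V. g k ((T ^^ k) w)) ^ (2 * p) \<partial>M) \<le> C * sqrt (real (card V)) ^ (2 * p)"
    using moment_bound[OF M mp dec r K \<open>1 \<le> 2 * p\<close>] by (elim exE conjE) (rule that)
  obtain c :: real where c: "0 \<le> c"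
    "\<forall>x\<ge>0. \<forall>y\<ge>0. (x + y) ^ (2 * p) \<le> 2 * y ^ (2 * p) + c * x ^ (2 * p)"
    using power_add_le_weighted[OF \<open>1 \<le> 2 * p\<close>] by blast
  show ?thesis
  proof (intro exI[of _ "(c + 1) * C"] conjI allI impI)
    show "0 \<le> (c + 1) * C" using c C by simp
    fix g n
    assume "observable_family M \<eta> K g \<and> (\<forall>k. (\<integral>w. g k w \<partial>M) = 0)"
    then have g: "observable_family M \<eta> K g" "\<forall>k. (\<integral>w. g k w \<partial>M) = 0" by auto
    have Tm: "T ^^ k \<in> measurable M M" for k
      using measure_preserving_funpow[OF mp] by (auto simp: measure_preserving_map_def)
    have "\<exists>B. integrable M B \<and> (\<forall>w. \<forall>m\<le>2 ^ n. \<bar>\<Sum>k\<in>{0..<0 + m}. g k ((T ^^ k) w)\<bar> ^ (2 * p) \<le> B w) \<and>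
        (\<integral>w. B w \<partial>M) \<le> (c + 1) * C * (2 ^ n) ^ p"
    proof (rule maximal_partial_sums[OF M _ _ p c(1)])
      show "(\<lambda>w. g k ((T ^^ k) w)) \<in> borel_measurable M" for k
        using g(1) by (intro measurable_compose[OF Tm]) (auto simp: observable_family_def)
      show "\<bar>g k ((T ^^ k) w)\<bar> \<le> 1" for k w using g(1) by (auto simp: observable_family_def)
      show "(\<integral>w. \<bar>\<Sum>k\<in>{a..<a + m}. g k ((T ^^ k) w)\<bar> ^ (2 * p) \<partial>M) \<le> C * real m ^ p" for a m
      proof -
        have "sqrt (real m) ^ (2 * p) = real m ^ p" by (simp add: power_mult)
        moreover have "\<bar>x\<bar> ^ (2 * p) = x ^ (2 * p)" for x :: real by (simp only: power_mult power2_abs)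
        ultimately show ?thesis using moment[rule_format, of g "{a..<a + m}"] g by simp
      qed
      show "(x + y) ^ (2 * p) \<le> 2 * y ^ (2 * p) + c * x ^ (2 * p)" if "0 \<le> x" "0 \<le> y" for x y
        using c(2) that by blast
    qed
    then show "\<exists>B. integrable M B \<and> (\<forall>w. \<forall>m\<le>2 ^ n. \<bar>\<Sum>k<m. g k ((T ^^ k) w)\<bar> ^ (2 * p) \<le> B w) \<and>
      (\<integral>w. B w \<partial>M) \<le> (c + 1) * C * (2 ^ n) ^ p"
      by (simp add: atLeast0LessThan)
  qed
qed

lemma averaged_field_bounded_lipschitz:
  fixes F :: "(real^'d) \<times> 'w \<Rightarrow> real^'d"
  assumes M: "prob_space M" and F: "F \<in> borel_measurable (borel \<Otimes>\<^sub>M M)"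
    and B: "\<And>z. norm (F z) \<le> B" and L: "\<And>w. L-lipschitz_on UNIV (\<lambda>x. F (x, w))"
  shows "integrable M (\<lambda>w. F (x, w))" "norm (averaged_field M F x) \<le> B"
    "L-lipschitz_on UNIV (averaged_field M F)"
proof -
  interpret prob_space M by fact
  have meas: "(\<lambda>w. F (x, w)) \<in> borel_measurable M" for x
    by (rule measurable_compose[OF measurable_Pair1' F]) simp
  show int: "integrable M (\<lambda>w. F (x, w))" for x
    by (rule integrable_const_bound[where B = B]) (use meas B in auto)
  have "norm (averaged_field M F x) \<le> (\<integral>w. norm (F (x, w)) \<partial>M)"
    unfolding averaged_field_def by (rule integral_norm_bound)
  also have "\<dots> \<le> (\<integral>w. B \<partial>M)" using int B by (intro integral_mono) auto
  finally show "norm (averaged_field M F x) \<le> B" by (simp add: prob_space)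
  show "L-lipschitz_on UNIV (averaged_field M F)"
  proof (rule lipschitz_onI)
    show "0 \<le> L" by (rule lipschitz_on_nonneg[OF L])
    fix x y
    have "dist (averaged_field M F x) (averaged_field M F y) = norm (\<integral>w. F (x, w) - F (y, w) \<partial>M)"
      unfolding averaged_field_def dist_norm using int by simp
    also have "\<dots> \<le> (\<integral>w. norm (F (x, w) - F (y, w)) \<partial>M)" by (rule integral_norm_bound)
    also have "\<dots> \<le> (\<integral>w. L * dist x y \<partial>M)"
    proof (rule integral_mono)
      show "norm (F (x, w) - F (y, w)) \<le> L * dist x y" for w
        using lipschitz_onD[OF L, of x y w] by (simp add: dist_norm)
    qed (use int in simp_all)
    finally show "dist (averaged_field M F x) (averaged_field M F y) \<le> L * dist x y"
      by (simp add: prob_space)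
  qed
qed

lemma averaged_solution_deriv:
  assumes "averaged_solution G x W"
  shows "continuous_on {0..} W" "0 < t \<Longrightarrow> (W has_vector_derivative G (W t)) (at t)"
proof -
  have d: "(W has_vector_derivative G (W t)) (at t within {0..})" if "t \<in> {0..}" for t
    using assms that by (auto simp: averaged_solution_def)
  show "continuous_on {0..} W" using d by (rule continuous_on_vector_derivative)
  show "(W has_vector_derivative G (W t)) (at t)" if "0 < t"
  proof -
    have "t \<in> interior {0..}" using that by (simp add: interior_real_atLeast)
    then have "at t within {0..} = at t" by (rule at_within_interior)
    then show ?thesis using d[of t] that by simp
  qed
qed

section \<open>The averaging estimate\<close>

theorem propositionA1p6:
  fixes M :: "'w::metric_space measure" and T :: "'w \<Rightarrow> 'w"
    and F :: "(real^'d) \<times> 'w \<Rightarrow> real^'d"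
    and X :: "real \<Rightarrow> real^'d \<Rightarrow> 'w \<Rightarrow> real \<Rightarrow> real^'d"
    and W :: "real^'d \<Rightarrow> real \<Rightarrow> real^'d"
    and \<eta> r0 T0 :: real
  assumes borel: "sets M = sets borel"
    and system: "invertible_prob_system M T"
    and eta: "0 < \<eta>" "\<eta> \<le> 1"
    and F_measurable: "F \<in> borel_measurable (borel \<Otimes>\<^sub>M M)"
    and F_bounded: "bounded (range F)"
    and F_lipschitz: "\<exists>L. \<forall>\<omega>. L-lipschitz_on UNIV (\<lambda>x. F (x, \<omega>))"
    and X_solution: "\<And>\<epsilon> x \<omega>. \<epsilon> > 0 \<Longrightarrow> perturbed_solution F T \<epsilon> x \<omega> (X \<epsilon> x \<omega>)"
    and W_solution: "\<And>x. averaged_solution (averaged_field M F) x (W x)"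
    and T0: "T0 > 0"
    and r0: "r0 \<ge> 1"
    and decorrelation: "decorrelation_property M T \<eta> r0"
    and F_holder: "\<exists>C. \<forall>x. holder_bound \<eta> C (\<lambda>\<omega>. F (x, \<omega>))"
  shows "\<forall>p::real. p \<ge> 1 \<longrightarrow>
    (\<exists>C::real. \<forall>\<^sub>F \<epsilon> in at_right 0.
       (SUP x. Lq_norm M (2 * p) (\<lambda>\<omega>. SUP t\<in>{0..T0}. infnorm (X \<epsilon> x \<omega> t - W x t)))
         \<le> ennreal (C * sqrt \<epsilon>))"
proof (intro allI impI)
  fix p :: real assume p: "1 \<le> p"
  have M: "prob_space M" and mp: "measure_preserving_map M T"
    using system by (auto simp: invertible_prob_system_def)
  interpret prob_space M by (rule M)
  have T: "T \<in> measurable M M" using mp by (simp add: measure_preserving_map_def)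
  obtain B0 where B0: "\<And>z. norm (F z) \<le> B0" using F_bounded by (auto simp: bounded_iff)
  define B where "B = max 1 B0"
  have B: "1 \<le> B" "norm (F z) \<le> B" for z using B0[of z] by (auto simp: B_def)
  obtain L where L: "\<And>\<omega>. L-lipschitz_on UNIV (\<lambda>x. F (x, \<omega>))" using F_lipschitz by blast
  have L0: "0 \<le> L" by (rule lipschitz_on_nonneg[OF L])
  obtain H0 where H0: "\<And>x. holder_bound \<eta> H0 (\<lambda>\<omega>. F (x, \<omega>))" using F_holder by blast
  define H where "H = max 0 H0"
  have H: "0 \<le> H" "norm (F (x, \<omega>) - F (x, \<omega>')) \<le> H * dist \<omega> \<omega>' powr \<eta>" for x \<omega> \<omega>'
  proof -
    show "0 \<le> H" by (simp add: H_def)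
    have "norm (F (x, \<omega>) - F (x, \<omega>')) \<le> H0 * dist \<omega> \<omega>' powr \<eta>"
      using H0[of x] by (auto simp: holder_bound_def)
    also have "\<dots> \<le> H * dist \<omega> \<omega>' powr \<eta>" by (intro mult_right_mono) (auto simp: H_def)
    finally show "norm (F (x, \<omega>) - F (x, \<omega>')) \<le> H * dist \<omega> \<omega>' powr \<eta>" .
  qed
  note avg = averaged_field_bounded_lipschitz[OF M F_measurable B(2) L]
  let ?G = "averaged_field M F"

  \<comment> \<open>The maximal inequality needs an integer exponent that is at least \<open>2\<close>.\<close>
  define P where "P = max 2 (nat \<lceil>p\<rceil>)"
  have P: "2 \<le> P" "p \<le> real P" by (auto simp: P_def) linarith
  obtain A where A: "0 \<le> A" and fluct:
    "\<forall>g n. observable_family M \<eta> H g \<and> (\<forall>k. (\<integral>w. g k w \<partial>M) = 0) \<longrightarrow>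
      (\<exists>B. integrable M B \<and> (\<forall>w. \<forall>m\<le>2 ^ n. \<bar>\<Sum>k<m. g k ((T ^^ k) w)\<bar> ^ (2 * P) \<le> B w) \<and>
        (\<integral>w. B w \<partial>M) \<le> A * (2 ^ n) ^ P)"
    using maximal_fluctuation[OF M mp decorrelation r0 H(1) P(1)] by (elim exE conjE) (rule that)
  define d where "d = real CARD('d)"
  define D where "D = (2 * B + 4 * L * B * T0) * exp (2 * L * T0) + 2 * B"
  have D: "0 \<le> D" using B(1) L0 T0 by (simp add: D_def)
  define E where "E = (2 * D) ^ (2 * P) * (T0 ^ P + d ^ (2 * P) * (d * (A * (2 * T0) ^ P)))"

  have main: "Lq_norm M (2 * p) (\<lambda>\<omega>. SUP t\<in>{0..T0}. infnorm (X \<epsilon> x \<omega> t - W x t))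
      \<le> ennreal ((1 + E) * sqrt \<epsilon>)" if \<epsilon>: "0 < \<epsilon>" "\<epsilon> < T0" for \<epsilon> x
  proof -
    let ?f = "\<lambda>\<omega>. SUP t\<in>{0..T0}. infnorm (X \<epsilon> x \<omega> t - W x t)"
    have sol: "perturbed_solution F T \<epsilon> x \<omega> (X \<epsilon> x \<omega>)" for \<omega> by (rule X_solution[OF \<epsilon>(1)])
    have Xc: "continuous_on {0..} (X \<epsilon> x \<omega>)" for \<omega> using sol by (simp add: perturbed_solution_def)
    have Wc: "continuous_on {0..} (W x)" by (rule averaged_solution_deriv(1)[OF W_solution])
    have cont: "continuous_on {0..T0} (\<lambda>t. infnorm (X \<epsilon> x \<omega> t - W x t))" for \<omega>
      by (intro continuous_intros continuous_on_subset[OF Xc] continuous_on_subset[OF Wc]) auto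
    have fm: "?f \<in> borel_measurable M"
    proof (rule borel_measurable_SUP_interval[OF _ cont])
      fix t assume "t \<in> {0..T0}"
      then have "(\<lambda>\<omega>. X \<epsilon> x \<omega> t) \<in> borel_measurable M"
        using perturbed_solution_measurable[OF F_measurable T B(2) L sol \<epsilon>(1)] by simp
      then have m: "(\<lambda>\<omega>. X \<epsilon> x \<omega> t - W x t) \<in> borel_measurable M" by simp
      have "continuous_on UNIV (infnorm :: real^'d \<Rightarrow> real)" by (intro continuous_intros)
      then have "(infnorm :: real^'d \<Rightarrow> real) \<in> borel_measurable borel"
        by (rule borel_measurable_continuous_onI)
      from measurable_compose[OF m this]
      show "(\<lambda>\<omega>. infnorm (X \<epsilon> x \<omega> t - W x t)) \<in> borel_measurable M" .
    qed (use T0 in simp)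

    \<comment> \<open>The dyadic number of cells \<open>2 ^ n\<close> covers \<open>{0..T0}\<close>, and by minimality at most \<open>{0..2 * T0}\<close>.\<close>
    define n where "n = (LEAST n. T0 / \<epsilon> < 2 ^ n)"
    have "\<exists>n. T0 / \<epsilon> < 2 ^ n" by (rule real_arch_pow) simp
    then have n1: "T0 / \<epsilon> < 2 ^ n" unfolding n_def by (rule LeastI_ex)
    have "1 < T0 / \<epsilon>" using \<epsilon> by simp
    with n1 have "n \<noteq> 0" by (intro notI) simp
    then obtain n' where n': "n = Suc n'" by (cases n) auto
    then have "\<not> T0 / \<epsilon> < 2 ^ n'" using not_less_Least[of n' "\<lambda>n. T0 / \<epsilon> < 2 ^ n"] by (simp add: n_def)
    then have n2: "2 ^ n * \<epsilon> \<le> 2 * T0" using \<epsilon> by (simp add: n' field_simps)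
    have n3: "T0 < 2 ^ n * \<epsilon>" using n1 \<epsilon> by (simp add: field_simps)

    define wk where "wk k = W x (real k * \<epsilon>)" for k
    \<comment> \<open>Coordinate \<open>c\<close> of the fluctuation along the averaged solution, normalised; \<open>wk k\<close> does not depend on \<open>\<omega>\<close>.\<close>
    define g where "g c k \<omega> = (F (wk k, \<omega>) $ c - ?G (wk k) $ c) / (2 * B)" for c k \<omega>
    have g_obs: "observable_family M \<eta> H (g c)" for c
      unfolding observable_family_def
    proof (intro allI conjI)
      fix k
      have "(\<lambda>\<omega>. F (wk k, \<omega>) $ c) \<in> borel_measurable M"
        by (rule borel_measurable_integrable[OF integrable_bounded_linear[OF bounded_linear_vec_nth avg(1)]])
      then show "g c k \<in> borel_measurable M"
        unfolding g_def by (intro borel_measurable_divide borel_measurable_diff borel_measurable_const)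
      show "\<bar>g c k \<omega>\<bar> \<le> 1" for \<omega>
      proof -
        have "\<bar>F (wk k, \<omega>) $ c\<bar> \<le> B" "\<bar>?G (wk k) $ c\<bar> \<le> B"
          using component_le_norm_cart[of "F (wk k, \<omega>)" c] B(2)[of "(wk k, \<omega>)"]
            component_le_norm_cart[of "?G (wk k)" c] avg(2)[of "wk k"] by linarith+
        then have "\<bar>F (wk k, \<omega>) $ c - ?G (wk k) $ c\<bar> \<le> 2 * B" by linarith
        then show ?thesis using B(1) by (simp add: g_def)
      qed
      show "holder_bound \<eta> H (g c k)"
        unfolding holder_bound_def
      proof (intro allI)
        fix \<omega> \<omega>'
        have "norm (g c k \<omega> - g c k \<omega>') = \<bar>(F (wk k, \<omega>) - F (wk k, \<omega>')) $ c\<bar> / (2 * B)"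
          using B(1) by (simp add: g_def flip: diff_divide_distrib)
        also have "\<dots> \<le> \<bar>(F (wk k, \<omega>) - F (wk k, \<omega>')) $ c\<bar> / 1"
          using B(1) by (intro divide_left_mono) auto
        also have "\<dots> \<le> H * dist \<omega> \<omega>' powr \<eta>"
          using component_le_norm_cart[of "F (wk k, \<omega>) - F (wk k, \<omega>')" c] H(2)[of "wk k" \<omega> \<omega>'] by simp
        finally show "norm (g c k \<omega> - g c k \<omega>') \<le> H * dist \<omega> \<omega>' powr \<eta>" .
      qed
    qed
    have g_mean: "(\<integral>\<omega>. g c k \<omega> \<partial>M) = 0" for c k
    proof -
      have int: "integrable M (\<lambda>\<omega>. F (wk k, \<omega>) $ c)"
        using integrable_bounded_linear[OF bounded_linear_vec_nth avg(1)] .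
      have "(\<integral>\<omega>. F (wk k, \<omega>) $ c \<partial>M) = ?G (wk k) $ c"
        unfolding averaged_field_def using integral_bounded_linear[OF bounded_linear_vec_nth avg(1)] .
      then show ?thesis unfolding g_def using int by (simp add: prob_space)
    qed
    have "\<exists>b. integrable M b \<and> (\<forall>\<omega>. \<forall>m\<le>2 ^ n. \<bar>\<Sum>k<m. g c k ((T ^^ k) \<omega>)\<bar> ^ (2 * P) \<le> b \<omega>) \<and>
        (\<integral>\<omega>. b \<omega> \<partial>M) \<le> A * (2 ^ n) ^ P" for c
      using fluct[rule_format, of "g c" n] g_obs g_mean by blast
    then obtain b where b_int: "\<And>c. integrable M (b c)"
      and b_dom: "\<And>c \<omega> m. m \<le> 2 ^ n \<Longrightarrow> \<bar>\<Sum>k<m. g c k ((T ^^ k) \<omega>)\<bar> ^ (2 * P) \<le> b c \<omega>"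
      and b_mean: "\<And>c. (\<integral>\<omega>. b c \<omega> \<partial>M) \<le> A * (2 ^ n) ^ P"
      by metis
    have b0: "0 \<le> b c \<omega>" for c \<omega>
      by (rule order_trans[OF _ b_dom[of 0]]) simp_all
    define \<mu> where "\<mu> c \<omega> = root (2 * P) (b c \<omega>)" for c \<omega>
    have \<mu>: "0 \<le> \<mu> c \<omega>" "\<mu> c \<omega> ^ (2 * P) = b c \<omega>" for c \<omega>
      using b0[of c \<omega>] P(1) by (auto simp: \<mu>_def)
    have \<mu>_dom: "\<bar>\<Sum>k<m. g c k ((T ^^ k) \<omega>)\<bar> \<le> \<mu> c \<omega>" if "m \<le> 2 ^ n" for c \<omega> m
      by (rule power_le_imp_le_base[of _ "2 * P - 1"])
        (use b_dom[OF that, of c \<omega>] \<mu> P(1) in \<open>simp_all\<close>)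

    have f_le: "?f \<omega> \<le> D * \<epsilon> * (1 + (\<Sum>c\<in>UNIV. \<mu> c \<omega>))" for \<omega>
    proof (rule cSUP_least)
      show "{0..T0} \<noteq> {}" using T0 by simp
      fix t assume t: "t \<in> {0..T0}"
      let ?S = "\<Sum>c\<in>UNIV. \<mu> c \<omega>"
      have S0: "0 \<le> ?S" using \<mu>(1) by (simp add: sum_nonneg)
      let ?N = "2 ^ n :: nat"
      have "norm (X \<epsilon> x \<omega> t - W x t) \<le>
        (\<epsilon> * (2 * B * ?S) + real ?N * (2 * L * B * \<epsilon>\<^sup>2)) * (1 + \<epsilon> * L) ^ ?N + 2 * B * \<epsilon>"
      proof (rule averaging_error[OF \<epsilon>(1)])
        show "X \<epsilon> x \<omega> 0 = W x 0"
          using sol[of \<omega>] W_solution[of x] by (simp add: perturbed_solution_def averaged_solution_def)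
        show "(X \<epsilon> x \<omega> has_vector_derivative F (X \<epsilon> x \<omega> s, (T ^^ k) \<omega>)) (at s)"
          if "real k * \<epsilon> < s" "s < real (Suc k) * \<epsilon>" for k s
          by (rule perturbed_solution_deriv[OF sol \<epsilon>(1) that])
        show "(W x has_vector_derivative ?G (W x s)) (at s)" if "0 < s" for s
          by (rule averaged_solution_deriv(2)[OF W_solution that])
        fix m assume m: "m \<le> ?N"
        let ?V = "\<Sum>k<m. F (W x (real k * \<epsilon>), (T ^^ k) \<omega>) - ?G (W x (real k * \<epsilon>))"
        have comp: "?V $ c = 2 * B * (\<Sum>k<m. g c k ((T ^^ k) \<omega>))" for c
          using B(1) by (simp add: g_def wk_def sum_distrib_left)
        have "norm ?V \<le> (\<Sum>c\<in>UNIV. \<bar>?V $ c\<bar>)" by (rule norm_le_l1_cart)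
        also have "\<dots> \<le> (\<Sum>c\<in>UNIV. 2 * B * \<mu> c \<omega>)"
          unfolding comp abs_mult using B(1) \<mu>_dom[OF m] by (intro sum_mono mult_mono) auto
        finally show "norm ?V \<le> 2 * B * ?S" by (simp add: sum_distrib_left)
      qed (use Xc Wc B L avg t n3 in auto)
      also have "\<dots> \<le> (\<epsilon> * (2 * B * ?S) + 4 * L * B * T0 * \<epsilon>) * exp (2 * L * T0) + 2 * B * \<epsilon>"
      proof (rule add_right_mono, rule mult_mono, rule add_left_mono)
        have "real ?N * (2 * L * B * \<epsilon>\<^sup>2) = (2 * L * B * \<epsilon>) * (2 ^ n * \<epsilon>)"
          by (simp add: power2_eq_square)
        also have "\<dots> \<le> (2 * L * B * \<epsilon>) * (2 * T0)"
          using n2 L0 B(1) \<epsilon> by (intro mult_left_mono) auto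
        finally show "real ?N * (2 * L * B * \<epsilon>\<^sup>2) \<le> 4 * L * B * T0 * \<epsilon>" by simp
        have "(1 + \<epsilon> * L) ^ ?N \<le> exp (\<epsilon> * L) ^ ?N"
          using \<epsilon> L0 by (intro power_mono exp_ge_add_one_self) auto
        also have "\<dots> = exp (L * (2 ^ n * \<epsilon>))" by (simp add: mult_ac flip: exp_of_nat_mult)
        also have "\<dots> \<le> exp (2 * L * T0)" using mult_left_mono[OF n2 L0] by simp
        finally show "(1 + \<epsilon> * L) ^ ?N \<le> exp (2 * L * T0)" .
      qed (use \<epsilon> B(1) L0 T0 S0 in auto)
      also have "\<dots> \<le> D * \<epsilon> * (1 + ?S)"
      proof -
        let ?e = "exp (2 * L * T0)"
        have "D * \<epsilon> * (1 + ?S) = (\<epsilon> * (2 * B * ?S) + 4 * L * B * T0 * \<epsilon>) * ?e + 2 * B * \<epsilon>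
            + (2 * B * \<epsilon> * ?e + 4 * L * B * T0 * \<epsilon> * ?S * ?e + 2 * B * \<epsilon> * ?S)"
          by (simp add: D_def algebra_simps)
        moreover have "0 \<le> 2 * B * \<epsilon> * ?e + 4 * L * B * T0 * \<epsilon> * ?S * ?e + 2 * B * \<epsilon> * ?S"
          using B(1) L0 T0 \<epsilon> S0 by (intro add_nonneg_nonneg mult_nonneg_nonneg) auto
        ultimately show ?thesis by linarith
      qed
      finally have "norm (X \<epsilon> x \<omega> t - W x t) \<le> D * \<epsilon> * (1 + ?S)" .
      from order_trans[OF infnorm_le_norm this]
      show "infnorm (X \<epsilon> x \<omega> t - W x t) \<le> D * \<epsilon> * (1 + ?S)" .
    qed
    have f0: "0 \<le> ?f \<omega>" for \<omega>
    proof -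
      have "bdd_above ((\<lambda>t. infnorm (X \<epsilon> x \<omega> t - W x t)) ` {0..T0})"
        using compact_continuous_image[OF cont[of \<omega>] compact_Icc]
        by (intro bounded_imp_bdd_above compact_imp_bounded)
      then have "infnorm (X \<epsilon> x \<omega> 0 - W x 0) \<le> ?f \<omega>" using T0 by (intro cSUP_upper) auto
      then show ?thesis using infnorm_pos_le order_trans by blast
    qed

    \<comment> \<open>Here the rate appears: \<open>f_le\<close> has a factor \<open>\<epsilon>\<close>, so dividing by \<open>sqrt \<epsilon>\<close> leaves \<open>\<epsilon> ^ P\<close>, which compensates
      the growth \<open>(2 ^ n) ^ P\<close> of the means of \<open>b c\<close> because \<open>2 ^ n * \<epsilon> \<le> 2 * T0\<close>.\<close>
    define h where "h \<omega> = (2 * D) ^ (2 * P) * \<epsilon> ^ P * (1 + d ^ (2 * P) * (\<Sum>c\<in>UNIV. b c \<omega>))" for \<omega>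
    have h_int: "integrable M h" unfolding h_def using b_int by simp
    have h_dom: "(?f \<omega> / sqrt \<epsilon>) ^ (2 * P) \<le> h \<omega>" for \<omega>
    proof -
      let ?S = "\<Sum>c\<in>UNIV. \<mu> c \<omega>"
      have S0: "0 \<le> ?S" using \<mu>(1) by (simp add: sum_nonneg)
      have S: "(1 + ?S) ^ (2 * P) \<le> 2 ^ (2 * P) * (1 + ?S ^ (2 * P))"
      proof (cases "?S \<le> 1")
        case True
        then have "(1 + ?S) ^ (2 * P) \<le> 2 ^ (2 * P) * 1" using S0 by (simp add: power_mono)
        also have "\<dots> \<le> 2 ^ (2 * P) * (1 + ?S ^ (2 * P))"
          using zero_le_power[OF S0, of "2 * P"] by (intro mult_left_mono) auto
        finally show ?thesis .
      next
        case False
        then have "(1 + ?S) ^ (2 * P) \<le> (2 * ?S) ^ (2 * P)" using S0 by (intro power_mono) auto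
        also have "\<dots> = 2 ^ (2 * P) * ?S ^ (2 * P)" by (rule power_mult_distrib)
        also have "\<dots> \<le> 2 ^ (2 * P) * (1 + ?S ^ (2 * P))" by (intro mult_left_mono) auto
        finally show ?thesis .
      qed
      have "?S ^ (2 * P) \<le> d ^ (2 * P) * (\<Sum>c\<in>UNIV. b c \<omega>)"
        using power_sum_le_sum_power[of UNIV "\<lambda>c. \<mu> c \<omega>" "2 * P"] \<mu> P(1) by (simp add: d_def)
      then have S': "(1 + ?S) ^ (2 * P) \<le> 2 ^ (2 * P) * (1 + d ^ (2 * P) * (\<Sum>c\<in>UNIV. b c \<omega>))"
        by (intro order_trans[OF S] mult_left_mono) auto
      have "?f \<omega> / sqrt \<epsilon> \<le> D * sqrt \<epsilon> * (1 + ?S)"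
      proof -
        have "D * sqrt \<epsilon> * (1 + ?S) * sqrt \<epsilon> = D * (1 + ?S) * (sqrt \<epsilon> * sqrt \<epsilon>)" by (simp only: mult_ac)
        also have "\<dots> = D * \<epsilon> * (1 + ?S)"
          using \<epsilon> by simp
        finally have "?f \<omega> \<le> D * sqrt \<epsilon> * (1 + ?S) * sqrt \<epsilon>" using f_le[of \<omega>] by (simp only:)
        then show ?thesis using \<epsilon> by (simp add: pos_divide_le_eq)
      qed
      then have "(?f \<omega> / sqrt \<epsilon>) ^ (2 * P) \<le> (D * sqrt \<epsilon> * (1 + ?S)) ^ (2 * P)"
        using f0[of \<omega>] \<epsilon> by (intro power_mono) auto
      also have "\<dots> = D ^ (2 * P) * \<epsilon> ^ P * (1 + ?S) ^ (2 * P)"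
        using \<epsilon> by (simp add: power_mult_distrib power_mult[of "sqrt \<epsilon>"])
      also have "\<dots> \<le> D ^ (2 * P) * \<epsilon> ^ P * (2 ^ (2 * P) * (1 + d ^ (2 * P) * (\<Sum>c\<in>UNIV. b c \<omega>)))"
        using D \<epsilon> S' by (intro mult_left_mono) auto
      also have "\<dots> = h \<omega>" by (simp only: h_def power_mult_distrib mult_ac)
      finally show ?thesis .
    qed
    have h_mean: "(\<integral>\<omega>. h \<omega> \<partial>M) \<le> E"
    proof -
      have "(\<integral>\<omega>. h \<omega> \<partial>M) = (2 * D) ^ (2 * P) * (\<epsilon> ^ P * (1 + d ^ (2 * P) * (\<Sum>c\<in>UNIV. \<integral>\<omega>. b c \<omega> \<partial>M)))"
        unfolding h_def using b_int by (simp add: prob_space mult.assoc)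
      also have "\<dots> \<le> (2 * D) ^ (2 * P) * (T0 ^ P + d ^ (2 * P) * (d * (A * (2 * T0) ^ P)))"
      proof (rule mult_left_mono)
        have "(\<Sum>c\<in>UNIV. \<integral>\<omega>. b c \<omega> \<partial>M) \<le> (\<Sum>c\<in>(UNIV :: 'd set). A * (2 ^ n) ^ P)"
          by (rule sum_mono) (rule b_mean)
        also have "\<dots> = d * (A * (2 ^ n) ^ P)" by (simp add: d_def)
        finally have "\<epsilon> ^ P * (\<Sum>c\<in>UNIV. \<integral>\<omega>. b c \<omega> \<partial>M) \<le> \<epsilon> ^ P * (d * (A * (2 ^ n) ^ P))"
          using \<epsilon> by (intro mult_left_mono) auto
        also have "\<dots> = d * (A * (2 ^ n * \<epsilon>) ^ P)" by (simp only: power_mult_distrib mult_ac)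
        also have "\<dots> \<le> d * (A * (2 * T0) ^ P)"
          using n2 \<epsilon> A by (intro mult_left_mono power_mono) (auto simp: d_def)
        finally have "d ^ (2 * P) * (\<epsilon> ^ P * (\<Sum>c\<in>UNIV. \<integral>\<omega>. b c \<omega> \<partial>M))
            \<le> d ^ (2 * P) * (d * (A * (2 * T0) ^ P))" by (intro mult_left_mono) (auto simp: d_def)
        moreover have "\<epsilon> ^ P \<le> T0 ^ P" using \<epsilon> by (intro power_mono) auto
        ultimately show "\<epsilon> ^ P * (1 + d ^ (2 * P) * (\<Sum>c\<in>UNIV. \<integral>\<omega>. b c \<omega> \<partial>M))
            \<le> T0 ^ P + d ^ (2 * P) * (d * (A * (2 * T0) ^ P))"
          by (simp only: distrib_left mult_1_right mult.left_commute[of "\<epsilon> ^ P"])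
      qed (use D in simp)
      also have "\<dots> = E" by (simp add: E_def)
      finally show ?thesis .
    qed
    show ?thesis
      by (rule Lq_norm_le_of_moment[OF M fm f0 _ h_int h_dom h_mean p P(2)]) (use \<epsilon> in simp)
  qed
  show "\<exists>C::real. \<forall>\<^sub>F \<epsilon> in at_right 0.
       (SUP x. Lq_norm M (2 * p) (\<lambda>\<omega>. SUP t\<in>{0..T0}. infnorm (X \<epsilon> x \<omega> t - W x t)))
         \<le> ennreal (C * sqrt \<epsilon>)"
  proof (rule exI[of _ "1 + E"])
    have "\<forall>\<^sub>F \<epsilon> in at_right 0. \<epsilon> \<in> {0<..<T0}" by (rule eventually_at_right_real[OF T0])
    then show "\<forall>\<^sub>F \<epsilon> in at_right 0.
       (SUP x. Lq_norm M (2 * p) (\<lambda>\<omega>. SUP t\<in>{0..T0}. infnorm (X \<epsilon> x \<omega> t - W x t)))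
         \<le> ennreal ((1 + E) * sqrt \<epsilon>)"
      by eventually_elim (intro SUP_least main, auto)
  qed
qed

end
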